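(* There exists an algorithm that, given a graphic sequence $d=(d_1,\ldots,d_n)$, runs in time polynomial in $n$ and outputs a simple graph $G$ realizing $d$ whose minimum dominating set has size $\textsc{MDS}(d)$, i.e., $G$ has a dominating set of minimum size among all realizations of $d$.
   Context: A sequence $d=(d_1,\ldots,d_n)$ is a non-increasing sequence of positive integers. A (simple, undirected) graph $G$ on vertices $1,\ldots,n$ realizes $d$ if $\deg_G(i)=d_i$ for all $i$; $d$ is graphic if some graph realizes it. A dominating set of $G$ is a set $D$ of vertices such that every vertex not in $D$ has a neighbour in $D$; $\textsc{MDS}(G)$ is the minimum size of a dominating set of $G$, and $\textsc{MDS}(d)=\min\{\textsc{MDS}(G) : G \text{ realizes } d\}$. *)

theory Defs
  imports "HOL-Computational_Algebra.Polynomial"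
begin

section \<open>Degree sequences and dominating sets\<close>

text \<open>
  Vertices are numbered from 0, so the vertex set of a graph on \<open>n\<close> vertices is \<open>{..<n}\<close> and a
  graph on it is given by its edge set \<open>E\<close>, a set of two-element sets of vertices.
\<close>

definition simple_graph :: "nat \<Rightarrow> nat set set \<Rightarrow> bool" where
  "simple_graph n E \<longleftrightarrow> E \<subseteq> {{u, v} | u v. u < n \<and> v < n \<and> u \<noteq> v}"

definition degree_of :: "nat set set \<Rightarrow> nat \<Rightarrow> nat" where
  "degree_of E v = card {u. {u, v} \<in> E}"

definition realizes :: "nat set set \<Rightarrow> nat list \<Rightarrow> bool" where
  "realizes E d \<longleftrightarrow> simple_graph (length d) E \<and> (\<forall>i<length d. degree_of E i = d ! i)"

definition degree_sequence :: "nat list \<Rightarrow> bool" where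
  "degree_sequence d \<longleftrightarrow> sorted_wrt (\<ge>) d \<and> (\<forall>x\<in>set d. 0 < x)"

definition graphic :: "nat list \<Rightarrow> bool" where
  "graphic d \<longleftrightarrow> degree_sequence d \<and> (\<exists>E. realizes E d)"

definition dominating_set :: "nat \<Rightarrow> nat set set \<Rightarrow> nat set \<Rightarrow> bool" where
  "dominating_set n E D \<longleftrightarrow> D \<subseteq> {..<n} \<and> (\<forall>v\<in>{..<n} - D. \<exists>u\<in>D. {u, v} \<in> E)"

definition MDS_graph :: "nat \<Rightarrow> nat set set \<Rightarrow> nat" where
  "MDS_graph n E = (LEAST k. \<exists>D. dominating_set n E D \<and> card D = k)"

definition MDS_seq :: "nat list \<Rightarrow> nat" where
  "MDS_seq d = (LEAST k. \<exists>E. realizes E d \<and> MDS_graph (length d) E = k)"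

section \<open>Algorithms: structured programs for a random access machine\<close>

text \<open>
  The machine has countably many arrays, of which a program can name only finitely many; each
  array has countably many cells holding natural numbers, and indices may be computed (indirect
  addressing).  Every evaluated syntax node costs one unit.  The arithmetic operations are only
  addition and truncated subtraction: they lengthen the binary representation of the largest
  stored number by at most one bit per step, so that this unit-cost machine is polynomially
  equivalent to Turing machines.  Multiplication at unit cost would destroy this.
\<close>

type_synonym memory = "nat \<Rightarrow> nat \<Rightarrow> nat"

datatype exp =
    Const nat
  | Cell nat exp
  | Plus exp exp
  | Minus exp exp

datatype test =
    Less exp exp
  | Neg test
  | Conj test test

datatype com =
    Skip
  | Assign nat exp exp
  | Seq com com
  | Cond test com com
  | While test com

fun eval_exp :: "exp \<Rightarrow> memory \<Rightarrow> nat" where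
  "eval_exp (Const c) s = c"
| "eval_exp (Cell a e) s = s a (eval_exp e s)"
| "eval_exp (Plus e f) s = eval_exp e s + eval_exp f s"
| "eval_exp (Minus e f) s = eval_exp e s - eval_exp f s"

fun eval_test :: "test \<Rightarrow> memory \<Rightarrow> bool" where
  "eval_test (Less e f) s \<longleftrightarrow> eval_exp e s < eval_exp f s"
| "eval_test (Neg b) s \<longleftrightarrow> \<not> eval_test b s"
| "eval_test (Conj b c) s \<longleftrightarrow> eval_test b s \<and> eval_test c s"

fun cost_exp :: "exp \<Rightarrow> nat" where
  "cost_exp (Const c) = 1"
| "cost_exp (Cell a e) = 1 + cost_exp e"
| "cost_exp (Plus e f) = 1 + cost_exp e + cost_exp f"
| "cost_exp (Minus e f) = 1 + cost_exp e + cost_exp f"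

fun cost_test :: "test \<Rightarrow> nat" where
  "cost_test (Less e f) = 1 + cost_exp e + cost_exp f"
| "cost_test (Neg b) = 1 + cost_test b"
| "cost_test (Conj b c) = 1 + cost_test b + cost_test c"

text \<open>
  \<open>exec c s t s'\<close>: started in memory \<open>s\<close>, the program \<open>c\<close> halts after exactly \<open>t\<close> steps in
  memory \<open>s'\<close>.  \<open>Assign a e f\<close> stores the value of \<open>f\<close> in the cell of array \<open>a\<close> whose index is
  the value of \<open>e\<close>.
\<close>

inductive exec :: "com \<Rightarrow> memory \<Rightarrow> nat \<Rightarrow> memory \<Rightarrow> bool" where
  Skip: "exec Skip s 1 s"
| Assign: "exec (Assign a e f) s (1 + cost_exp e + cost_exp f)
            (s(a := (s a)(eval_exp e s := eval_exp f s)))"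
| Seq: "exec c s t s' \<Longrightarrow> exec c' s' t' s'' \<Longrightarrow> exec (Seq c c') s (t + t') s''"
| CondTrue: "eval_test b s \<Longrightarrow> exec c s t s' \<Longrightarrow> exec (Cond b c c') s (1 + cost_test b + t) s'"
| CondFalse: "\<not> eval_test b s \<Longrightarrow> exec c' s t s' \<Longrightarrow> exec (Cond b c c') s (1 + cost_test b + t) s'"
| WhileFalse: "\<not> eval_test b s \<Longrightarrow> exec (While b c) s (1 + cost_test b) s"
| WhileTrue: "eval_test b s \<Longrightarrow> exec c s t s' \<Longrightarrow> exec (While b c) s' t' s'' \<Longrightarrow>
    exec (While b c) s (1 + cost_test b + t + t') s''"

inductive_cases SkipE: "exec Skip s t s'"
inductive_cases AssignE: "exec (Assign a e f) s t s'"
inductive_cases SeqE: "exec (Seq c c') s t s'"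
inductive_cases CondE: "exec (Cond b c c') s t s'"
inductive_cases WhileE: "exec (While b c) s t s'"

lemma exec_deterministic:
  "exec c s t s' \<Longrightarrow> exec c s u s'' \<Longrightarrow> u = t \<and> s'' = s'"
proof (induction arbitrary: u s'' rule: exec.induct)
  case Skip
  then show ?case by (auto elim: SkipE)
next
  case Assign
  then show ?case by (auto elim: AssignE)
next
  case Seq
  from Seq.prems show ?case by (rule SeqE) (auto dest!: Seq.IH)
next
  case CondTrue
  from CondTrue.prems show ?case by (rule CondE) (use CondTrue.hyps in \<open>auto dest!: CondTrue.IH\<close>)
next
  case CondFalse
  from CondFalse.prems show ?case by (rule CondE) (use CondFalse.hyps in \<open>auto dest!: CondFalse.IH\<close>)
next
  case WhileFalse
  from WhileFalse.prems show ?case by (rule WhileE) (use WhileFalse.hyps in auto)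
next
  case WhileTrue
  from WhileTrue.prems show ?case by (rule WhileE) (use WhileTrue.hyps in \<open>auto dest!: WhileTrue.IH\<close>)
qed

section \<open>Input and output conventions\<close>

text \<open>
  Initially cell 0 of array 0 holds the length of the sequence, array 1 holds its entries, and
  all other cells are 0.  On halting, cell 0 of array 2 holds the length of an edge list whose
  endpoints are in arrays 3 and 4; the graph it denotes is the set of the listed edges.
\<close>

definition input_memory :: "nat list \<Rightarrow> memory" where
  "input_memory d a i =
     (if a = 0 \<and> i = 0 then length d else if a = 1 \<and> i < length d then d ! i else 0)"

definition output_graph :: "memory \<Rightarrow> nat set set" where
  "output_graph s = {{s 3 k, s 4 k} | k. k < s 2 0}"

end

theory Submission
  imports Defs
begin

text \<open>
  Let \<open>k\<close> be the optimum. An exchange argument shows that some realization is dominated by its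
  \<open>k\<close> vertices of largest degree, the core. Split the degree of every other vertex \<open>v\<close> into
  a number of neighbours in the core, which must be at least 1, and a number \<open>c v\<close> of
  neighbours outside of it. Because \<open>k\<close> is minimal, in such a realization one unit of \<open>c\<close> can be
  moved from \<open>p\<close> to \<open>z\<close> whenever \<open>c z < c p\<close> and the bounds \<open>d v - k \<le> c v < d v\<close> allow
  it. So \<open>c\<close> can be levelled out: for one of the \<open>n\<^sup>2\<close> pairs \<open>(M, r)\<close>,
  \<open>c v\<close> may be taken to be \<open>M\<close>, or \<open>M + 1\<close> if \<open>v < r\<close>, clamped to these bounds. For a
  given \<open>c\<close>, the edges meeting the core and the edges avoiding it can be chosen
  independently of each other, both greedily in the manner of Havel and Hakimi.
  The program tries all \<open>k\<close>, \<open>M\<close> and \<open>r\<close> and keeps its first success.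
\<close>

section \<open>Neighbourhoods and switches\<close>

text \<open>Trying all vectors \<open>c\<close> would take exponential time, and one vector per
  \<open>k\<close> would not do: the sum of \<open>c\<close> depends on the number of edges inside
  the core, which \<open>d\<close> and \<open>k\<close> leave open. But a move keeps this sum, so
  one levelled vector per sum is enough. Coding \<open>(M, r)\<close> as
  \<open>T = M * n + r\<close>, the clamped vectors start at the lower bounds, end no lower than the
  upper ones, and their sum rises by at most one per step; so every sum that can occur is met. In
  the rearrangements the difficulty is to keep domination intact. Where no switch fits, the
  neighbours of some vertex form a clique, and one of them has larger degree than that vertex. For a
  core vertex with all neighbours outside this is a contradiction; in the exchange of dominators it
  supplies a better dominator. Each greedy pass is analysed in two halves: what it has built is
  right in any case, and it finishes if a realization exists. Hence a success certifies itself, and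
  trying infeasible \<open>k\<close>, \<open>M\<close> and \<open>r\<close> does no harm.\<close>

definition nbrs :: "nat set set \<Rightarrow> nat \<Rightarrow> nat set" where
  "nbrs E v = {u. {u, v} \<in> E}"

lemma degree_of_nbrs: "degree_of E v = card (nbrs E v)"
  by (simp add: degree_of_def nbrs_def)

lemma nbrs_sym: "u \<in> nbrs E v \<longleftrightarrow> v \<in> nbrs E u"
  by (simp add: nbrs_def insert_commute)

lemma simple_graph_edge:
  "simple_graph n E \<Longrightarrow> {u, v} \<in> E \<Longrightarrow> u < n \<and> v < n \<and> u \<noteq> v"
  by (force simp: simple_graph_def doubleton_eq_iff)

lemma nbrs_subset: "simple_graph n E \<Longrightarrow> nbrs E v \<subseteq> {..<n} - {v}"
  by (auto simp: nbrs_def dest: simple_graph_edge)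

lemma finite_nbrs: "simple_graph n E \<Longrightarrow> finite (nbrs E v)"
  by (meson finite_Diff finite_lessThan nbrs_subset finite_subset)

lemma nbrs_irrefl: "simple_graph n E \<Longrightarrow> v \<notin> nbrs E v"
  using nbrs_subset by blast

lemma nbrs_less: "simple_graph n E \<Longrightarrow> u \<in> nbrs E v \<Longrightarrow> u < n"
  using nbrs_subset by blast

text \<open>The classical 2-switch: under \<open>switchable\<close>, the cycle \<open>a\<close>,
  \<open>b\<close>, \<open>e\<close>, \<open>c\<close> alternates between edges and non-edges, and
  the two kinds are interchanged.\<close>

definition switch :: "nat set set \<Rightarrow> nat \<Rightarrow> nat \<Rightarrow> nat \<Rightarrow> nat \<Rightarrow> nat set set" where
  "switch E a b c e = (E - {{a, b}, {c, e}}) \<union> {{a, c}, {b, e}}"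

definition switchable :: "nat set set \<Rightarrow> nat \<Rightarrow> nat \<Rightarrow> nat \<Rightarrow> nat \<Rightarrow> bool" where
  "switchable E a b c e \<longleftrightarrow> distinct [a, b, c, e] \<and> b \<in> nbrs E a \<and> e \<in> nbrs E c \<and>
     c \<notin> nbrs E a \<and> e \<notin> nbrs E b"

lemma nbrs_switch:
  assumes "switchable E a b c e"
  shows "nbrs (switch E a b c e) v =
    (if v = a then insert c (nbrs E a - {b}) else if v = b then insert e (nbrs E b - {a})
     else if v = c then insert a (nbrs E c - {e}) else if v = e then insert b (nbrs E e - {c})
     else nbrs E v)"
  using assms unfolding switchable_def switch_def nbrs_def by (auto simp: doubleton_eq_iff insert_commute)

lemma simple_graph_switch:
  assumes "simple_graph n E" "switchable E a b c e"
  shows "simple_graph n (switch E a b c e)"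
proof -
  have "{b, a} \<in> E" "{e, c} \<in> E" "a \<noteq> c" "b \<noteq> e"
    using assms(2) by (auto simp: switchable_def nbrs_def)
  then have "a < n" "b < n" "c < n" "e < n"
    using simple_graph_edge[OF assms(1)] by blast+
  then have "{{a, c}, {b, e}} \<subseteq> {{u, v} | u v. u < n \<and> v < n \<and> u \<noteq> v}"
    using \<open>a \<noteq> c\<close> \<open>b \<noteq> e\<close> by blast
  then show ?thesis
    using assms(1) unfolding simple_graph_def switch_def by blast
qed

lemma card_insert_Diff:
  assumes "finite A" "b \<in> A" "c \<notin> A"
  shows "card (insert c (A - {b})) = card A"
proof -
  have "card (insert c (A - {b})) = Suc (card (A - {b}))" using assms by simp
  also have "\<dots> = card A" using assms by (simp only: card_Suc_Diff1)
  finally show ?thesis .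
qed

lemma card_nbrs_switch:
  assumes "simple_graph n E" "switchable E a b c e"
  shows "card (nbrs (switch E a b c e) v) = card (nbrs E v)"
proof -
  have "b \<in> nbrs E a" "a \<in> nbrs E b" "e \<in> nbrs E c" "c \<in> nbrs E e"
    "c \<notin> nbrs E a" "a \<notin> nbrs E c" "e \<notin> nbrs E b" "b \<notin> nbrs E e"
    using assms(2) nbrs_sym unfolding switchable_def by blast+
  then show ?thesis
    using finite_nbrs[OF assms(1)] by (simp add: nbrs_switch[OF assms(2)] card_insert_Diff del: card_insert_disjoint)
qed

lemma realizes_nbrs:
  "realizes E d \<longleftrightarrow> simple_graph (length d) E \<and> (\<forall>i<length d. card (nbrs E i) = d ! i)"
  by (simp add: realizes_def degree_of_nbrs)

lemma realizes_switch:
  "realizes E d \<Longrightarrow> switchable E a b c e \<Longrightarrow> realizes (switch E a b c e) d"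
  using simple_graph_switch card_nbrs_switch unfolding realizes_nbrs by metis

text \<open>Adjacency is symmetric, so removing \<open>i\<close> and \<open>j\<close> from each
  other's neighbourhoods keeps the comparison of sizes. If all remaining neighbours of
  \<open>i\<close> were neighbours of \<open>j\<close>, they would have to fit into
  \<open>nbrs E j - {i}\<close> without \<open>w\<close>, which is too small.\<close>

lemma nbrs_exchange:
  assumes "simple_graph n E" "card (nbrs E j) \<le> card (nbrs E i)"
    and "w \<in> nbrs E j" "w \<notin> nbrs E i" "w \<noteq> i"
  obtains x where "x \<in> nbrs E i" "x \<notin> nbrs E j" "x \<noteq> j"
proof -
  have *: "i \<in> nbrs E j \<longleftrightarrow> j \<in> nbrs E i" by (rule nbrs_sym)
  have fin: "finite (nbrs E i)" "finite (nbrs E j)" using finite_nbrs[OF assms(1)] by auto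
  have "card (nbrs E j - {i}) \<le> card (nbrs E i - {j})"
    using assms fin * by (cases "i \<in> nbrs E j") (auto simp: card_Diff_singleton)
  moreover have "card (nbrs E j - {i} - {w}) < card (nbrs E j - {i})"
    using assms fin by (intro psubset_card_mono) auto
  moreover have "card (nbrs E i - {j}) \<le> card (nbrs E j - {i} - {w})"
    if "\<And>x. x \<in> nbrs E i \<Longrightarrow> x \<noteq> j \<Longrightarrow> x \<in> nbrs E j"
    using that assms fin nbrs_irrefl[OF assms(1)] by (intro card_mono) auto
  ultimately show ?thesis
    using that by (meson leD le_trans)
qed

lemma nbrs_exchange_strict:
  assumes "simple_graph n E" "card (nbrs E j) < card (nbrs E i)"
  obtains x where "x \<in> nbrs E i" "x \<notin> nbrs E j" "x \<noteq> j"
proof -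
  have *: "i \<in> nbrs E j \<longleftrightarrow> j \<in> nbrs E i" by (rule nbrs_sym)
  have fin: "finite (nbrs E i)" "finite (nbrs E j)" using finite_nbrs[OF assms(1)] by auto
  have "card (nbrs E j - {i}) < card (nbrs E i - {j})"
  proof (cases "i \<in> nbrs E j")
    case True
    then have "0 < card (nbrs E j)" using fin by (auto simp: card_gt_0_iff)
    then show ?thesis using True assms(2) fin * by (auto simp: card_Diff_singleton)
  qed (use assms(2) * in auto)
  moreover have "card (nbrs E i - {j}) \<le> card (nbrs E j - {i})"
    if "\<And>x. x \<in> nbrs E i \<Longrightarrow> x \<noteq> j \<Longrightarrow> x \<in> nbrs E j"
    using that fin nbrs_irrefl[OF assms(1)] by (intro card_mono) auto
  ultimately show ?thesis
    using that by (meson leD)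
qed

section \<open>Dominating sets and the two minima\<close>

lemma dominating_set_nbrs:
  "dominating_set n E D \<longleftrightarrow> D \<subseteq> {..<n} \<and> (\<forall>v<n. v \<notin> D \<longrightarrow> nbrs E v \<inter> D \<noteq> {})"
  unfolding dominating_set_def nbrs_def by (auto; blast)

lemma MDS_graph_le: "dominating_set n E D \<Longrightarrow> MDS_graph n E \<le> card D"
  unfolding MDS_graph_def by (rule Least_le) blast

lemma MDS_graph_attained: obtains D where "dominating_set n E D" "card D = MDS_graph n E"
proof -
  have "\<exists>D. dominating_set n E D \<and> card D = n"
    by (rule exI[of _ "{..<n}"]) (simp add: dominating_set_def)
  then have "\<exists>D. dominating_set n E D \<and> card D = MDS_graph n E"
    unfolding MDS_graph_def by (rule LeastI)
  then show ?thesis using that by blast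
qed

lemma MDS_seq_le: "realizes E d \<Longrightarrow> MDS_seq d \<le> MDS_graph (length d) E"
  unfolding MDS_seq_def by (rule Least_le) blast

lemma MDS_seq_attained:
  assumes "realizes E d"
  obtains E' where "realizes E' d" "MDS_graph (length d) E' = MDS_seq d"
proof -
  have "\<exists>E'. realizes E' d \<and> MDS_graph (length d) E' = MDS_graph (length d) E" using assms by blast
  then have "\<exists>E'. realizes E' d \<and> MDS_graph (length d) E' = MDS_seq d"
    unfolding MDS_seq_def by (rule LeastI)
  then show ?thesis using that by blast
qed

lemma MDS_seq_minimal:
  "realizes E d \<Longrightarrow> dominating_set (length d) E D \<Longrightarrow> MDS_seq d \<le> card D"
  using MDS_seq_le MDS_graph_le order_trans by blast

lemma degree_sequence_mono:
  "degree_sequence d \<Longrightarrow> i \<le> j \<Longrightarrow> j < length d \<Longrightarrow> d ! j \<le> d ! i"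
  unfolding degree_sequence_def by (cases "i = j") (auto simp: sorted_wrt_iff_nth_less)

lemma degree_sequence_pos: "degree_sequence d \<Longrightarrow> i < length d \<Longrightarrow> 0 < d ! i"
  unfolding degree_sequence_def by auto

section \<open>Moving a neighbour outside the core\<close>

text \<open>The \<open>c v\<close> of the overview. As \<open>d\<close> is non-increasing, the core
  of size \<open>k\<close> is the initial segment \<open>{..<k}\<close>.\<close>

definition odeg :: "nat \<Rightarrow> nat set set \<Rightarrow> nat \<Rightarrow> nat" where
  "odeg k E v = card (nbrs E v \<inter> {k..})"

definition covered :: "nat \<Rightarrow> nat \<Rightarrow> nat set set \<Rightarrow> bool" where
  "covered n k E \<longleftrightarrow> (\<forall>v. k \<le> v \<and> v < n \<longrightarrow> nbrs E v \<inter> {..<k} \<noteq> {})"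

lemma covered_iff_dominating_set:
  "k \<le> n \<Longrightarrow> covered n k E \<longleftrightarrow> dominating_set n E {..<k}"
  by (auto simp: covered_def dominating_set_nbrs)

lemma odeg_card_nbrs:
  assumes "simple_graph n E"
  shows "card (nbrs E v \<inter> {..<k}) + odeg k E v = card (nbrs E v)"
proof -
  have "nbrs E v = (nbrs E v \<inter> {..<k}) \<union> (nbrs E v \<inter> {k..})" by auto
  then show ?thesis
    unfolding odeg_def using finite_nbrs[OF assms, of v]
    by (metis (no_types, lifting) card_Un_disjoint disjoint_iff finite_Int IntE atLeast_iff lessThan_iff not_le)
qed

lemma nbrs_outside:
  "k \<le> v \<Longrightarrow> nbrs {e \<in> E. e \<inter> {..<k} = {}} v = nbrs E v \<inter> {k..}"
  by (auto simp: nbrs_def)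

text \<open>In the graph without the edges that meet the core, outside degrees are ordinary degrees,
  so the strict exchange lemma yields \<open>y\<close>.\<close>

lemma odeg_exchange:
  assumes "simple_graph n E" "k \<le> p" "k \<le> z" "odeg k E z < odeg k E p"
  obtains y where "k \<le> y" "y \<in> nbrs E p" "y \<notin> nbrs E z" "y \<noteq> z"
proof -
  have "simple_graph n {e \<in> E. e \<inter> {..<k} = {}}"
    using assms(1) by (auto simp: simple_graph_def)
  then show ?thesis
    using nbrs_exchange_strict[of n "{e \<in> E. e \<inter> {..<k} = {}}" z p] assms that
    by (auto simp: nbrs_outside odeg_def)
qed

text \<open>The switch trades the edges from \<open>j\<close> to \<open>z\<close> and from
  \<open>p\<close> to \<open>y\<close> for edges from \<open>j\<close> to \<open>p\<close> and from
  \<open>z\<close> to \<open>y\<close>. Thus \<open>p\<close> swaps an outside neighbour for a core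
  neighbour, \<open>z\<close> does the reverse and stays covered by a second core neighbour, and
  \<open>y\<close> swaps one outside neighbour for another.\<close>

lemma move_direct:
  assumes real: "realizes E d" and cov: "covered (length d) k E"
    and pz: "k \<le> p" "k \<le> z" and two: "2 \<le> card (nbrs E z \<inter> {..<k})"
    and j: "j < k" "j \<in> nbrs E z" "j \<notin> nbrs E p"
    and y: "k \<le> y" "y \<in> nbrs E p" "y \<notin> nbrs E z" "y \<noteq> z"
  shows "\<exists>E'. realizes E' d \<and> covered (length d) k E' \<and>
    (\<forall>v\<ge>k. odeg k E' v = (if v = p then odeg k E p - 1 else if v = z then odeg k E z + 1 else odeg k E v))"
proof -
  let ?E = "switch E j z p y"
  have sg: "simple_graph (length d) E" using real by (simp add: realizes_nbrs)
  note irr = nbrs_irrefl[OF sg] and fin = finite_nbrs[OF sg]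
  have dist: "p \<noteq> z" "p \<noteq> y" "j \<noteq> y" using j y irr by auto
  have sw: "switchable E j z p y"
    unfolding switchable_def using dist j y pz by (auto simp: nbrs_sym)
  note nb = nbrs_switch[OF sw]
  have nbp: "nbrs ?E p = insert j (nbrs E p - {y})" and nbz: "nbrs ?E z = insert y (nbrs E z - {j})"
    and nby: "nbrs ?E y = insert z (nbrs E y - {p})"
    and nbo: "\<And>v. v \<noteq> p \<Longrightarrow> v \<noteq> z \<Longrightarrow> v \<noteq> y \<Longrightarrow> k \<le> v \<Longrightarrow> nbrs ?E v = nbrs E v"
    using dist j(1) pz y(1,4) by (auto simp: nb)
  have "\<not> nbrs E z \<inter> {..<k} \<subseteq> {j}"
    using two card_mono[of "{j}" "nbrs E z \<inter> {..<k}"] by auto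
  then have "nbrs ?E z \<inter> {..<k} \<noteq> {}" unfolding nbz by blast
  moreover have "nbrs ?E y \<inter> {..<k} \<noteq> {}" if "y < length d"
    using cov y(1) that pz unfolding nby covered_def by fastforce
  ultimately have cov': "covered (length d) k ?E"
    using cov j(1) unfolding covered_def by (metis nbo nbp IntI empty_iff insertI1 lessThan_iff)
  have p_eq: "nbrs ?E p \<inter> {k..} = nbrs E p \<inter> {k..} - {y}" unfolding nbp using j(1) by auto
  have z_eq: "nbrs ?E z \<inter> {k..} = insert y (nbrs E z \<inter> {k..})" unfolding nbz using j(1) y(1) by auto
  have y_eq: "nbrs ?E y \<inter> {k..} = insert z (nbrs E y \<inter> {k..} - {p})" unfolding nby using pz by auto
  have "odeg k ?E p = odeg k E p - 1"
    unfolding odeg_def p_eq using y fin by (simp add: card_Diff_singleton)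
  moreover have "odeg k ?E z = odeg k E z + 1"
    unfolding odeg_def z_eq using y fin by simp
  moreover have "odeg k ?E y = odeg k E y"
    unfolding odeg_def y_eq using y fin pz nbrs_sym[of y] by (intro card_insert_Diff) auto
  ultimately have "\<forall>v\<ge>k. odeg k ?E v = (if v = p then odeg k E p - 1 else if v = z then odeg k E z + 1 else odeg k E v)"
    using dist y nbo by (metis odeg_def)
  then show ?thesis using realizes_switch[OF real sw] cov' by blast
qed

text \<open>Prepares \<open>move_direct\<close> when \<open>p\<close> has every core neighbour of
  \<open>z\<close>: here \<open>z\<close> trades \<open>j\<close> for a core vertex
  \<open>j'\<close>, in the application one that \<open>p\<close> lacks. If \<open>x\<close> lies
  outside the core, it trades \<open>j'\<close> for \<open>j\<close>, so every outside vertex keeps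
  its number of core neighbours.\<close>

lemma reroute_dominator:
  assumes real: "realizes E d" and cov: "covered (length d) k E"
    and jj: "j < k" "j' < k" "k \<le> z" and j: "j \<in> nbrs E z" "j' \<notin> nbrs E z"
    and x: "x \<in> nbrs E j'" "x \<notin> nbrs E j" "x \<noteq> j"
  defines "E' \<equiv> switch E z j j' x"
  shows "realizes E' d" "covered (length d) k E'" "\<And>v. k \<le> v \<Longrightarrow> odeg k E' v = odeg k E v"
    "j' \<in> nbrs E' z" "card (nbrs E' z \<inter> {..<k}) = card (nbrs E z \<inter> {..<k})"
    "\<And>v. k \<le> v \<Longrightarrow> v \<noteq> z \<Longrightarrow> v \<noteq> x \<Longrightarrow> nbrs E' v = nbrs E v"
    "nbrs E' z \<inter> {k..} = nbrs E z \<inter> {k..}"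
proof -
  have sg: "simple_graph (length d) E" using real by (simp add: realizes_nbrs)
  note irr = nbrs_irrefl[OF sg] and fin = finite_nbrs[OF sg]
  have dist: "j \<noteq> j'" "x \<noteq> j'" "x \<noteq> z" using j x jj irr nbrs_sym[of z E j'] by auto
  have sw: "switchable E z j j' x"
    unfolding switchable_def using dist j x jj by auto
  note nb = nbrs_switch[OF sw]
  show "realizes E' d" unfolding E'_def by (rule realizes_switch[OF real sw])
  have nbz: "nbrs E' z = insert j' (nbrs E z - {j})" by (simp add: E'_def nb)
  show nbo: "\<And>v. k \<le> v \<Longrightarrow> v \<noteq> z \<Longrightarrow> v \<noteq> x \<Longrightarrow> nbrs E' v = nbrs E v"
    using jj by (auto simp: E'_def nb)
  show "j' \<in> nbrs E' z" by (simp add: nbz)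
  show zo: "nbrs E' z \<inter> {k..} = nbrs E z \<inter> {k..}" using jj by (auto simp: nbz)
  have "nbrs E' z \<inter> {..<k} = insert j' (nbrs E z \<inter> {..<k} - {j})" using jj by (auto simp: nbz)
  then show "card (nbrs E' z \<inter> {..<k}) = card (nbrs E z \<inter> {..<k})"
    using jj j fin by (simp add: card_insert_Diff del: card_insert_disjoint)
  have nbx: "nbrs E' x = insert j (nbrs E x - {j'})" if "k \<le> x"
    using dist that jj by (auto simp: E'_def nb)
  show "covered (length d) k E'"
    using cov jj nbo nbx nbz unfolding covered_def
    by (metis IntI empty_iff insertI1 lessThan_iff)
  have "nbrs E' x \<inter> {k..} = nbrs E x \<inter> {k..}" if "k \<le> x" using jj that by (auto simp: nbx)
  then show "odeg k E' v = odeg k E v" if "k \<le> v" for v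
    using that zo nbo unfolding odeg_def by metis
qed

text \<open>Minimality of \<open>k\<close> is what makes the move possible: when no exchange works, some \<open>j' < k\<close> is
  superfluous, possibly after a switch, or one of its neighbours has larger degree than \<open>j'\<close>.\<close>

lemma superfluous_dominator:
  assumes deg: "degree_sequence d" and real: "realizes E d" and cov: "covered (length d) k E"
    and k: "k \<le> length d"
    and j: "j1 < k" "j2 < k" "j' < k" "distinct [j1, j2, j']"
    and sub: "nbrs E j' - {j1} \<subseteq> nbrs E j1" "nbrs E j' - {j2} \<subseteq> nbrs E j2"
  shows "\<exists>E' D. realizes E' d \<and> dominating_set (length d) E' D \<and> card D < k"
proof -
  let ?n = "length d" and ?D = "{..<k} - {j'}"
  have sg: "simple_graph ?n E" using real by (simp add: realizes_nbrs)
  note irr = nbrs_irrefl[OF sg] and fin = finite_nbrs[OF sg]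
  have cardD: "card ?D < k" using j by simp
  have Dn: "?D \<subseteq> {..<?n}" using k by auto
  have dom: "nbrs E v \<inter> ?D \<noteq> {}" if v: "k \<le> v" "v < ?n" for v
  proof (cases "j' \<in> nbrs E v")
    case True
    then have "v \<in> nbrs E j1" using sub v j nbrs_sym[of v E j'] by auto
    then have "j1 \<in> nbrs E v" using nbrs_sym by blast
    then show ?thesis using j by auto
  next
    case False
    then show ?thesis using cov v unfolding covered_def by blast
  qed
  show ?thesis
  proof (cases "nbrs E j' \<inter> ?D = {}")
    case False
    then have "dominating_set ?n E ?D"
      unfolding dominating_set_nbrs using dom Dn by (auto simp: not_less)
    then show ?thesis using real cardD by blast
  next
    case True
    have notin: "x \<notin> nbrs E j'" if "x < k" for x
      using that True irr[of j'] by (cases "x = j'") auto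
    have adj: "j1 \<in> nbrs E x" "j2 \<in> nbrs E x" if "x \<in> nbrs E j'" for x
      using that sub notin[OF j(1)] notin[OF j(2)] nbrs_sym[of x] by blast+
    show ?thesis
    proof (cases "\<exists>x x'. x \<in> nbrs E j' \<and> x' \<in> nbrs E j' \<and> x \<noteq> x' \<and> x \<notin> nbrs E x'")
      case True
      then obtain x x' where x: "x \<in> nbrs E j'" "x' \<in> nbrs E j'" "x \<noteq> x'" "x \<notin> nbrs E x'" by blast
      have xk: "k \<le> x" "k \<le> x'" using x notin by (meson not_le)+
      \<comment> \<open>After the switch \<open>j1\<close> dominates \<open>j'\<close>;
        \<open>x\<close> keeps \<open>j1\<close>, and \<open>x'\<close>, which loses
        \<open>j1\<close>, keeps \<open>j2\<close>. This is where two core vertices with the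
        neighbours of \<open>j'\<close> are needed.\<close>
      have "x' \<in> nbrs E j1" "j' \<notin> nbrs E j1"
        using adj[OF x(2)] notin[OF j(1)] nbrs_sym by blast+
      then have sw: "switchable E j1 x' j' x"
        unfolding switchable_def using x xk j by auto
      let ?E = "switch E j1 x' j' x"
      note nb = nbrs_switch[OF sw]
      have "nbrs ?E v \<inter> ?D \<noteq> {}" if v: "v < ?n" "v \<notin> ?D" for v
      proof -
        consider "v = j'" | "v = x" | "v = x'" | "k \<le> v" "v \<noteq> x" "v \<noteq> x'"
          using v by fastforce
        then show ?thesis
        proof cases
          case 1
          then have "j1 \<in> nbrs ?E v" using x xk j by (auto simp: nb)
          then show ?thesis using j by auto
        next
          case 2
          then have "j1 \<in> nbrs ?E v" using x xk j adj by (auto simp: nb)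
          then show ?thesis using j by auto
        next
          case 3
          then have "j2 \<in> nbrs ?E v" using x xk j adj by (auto simp: nb)
          then show ?thesis using j by auto
        next
          case 4
          then have "nbrs ?E v = nbrs E v" using j by (auto simp: nb)
          then show ?thesis using dom 4 v by simp
        qed
      qed
      then have "dominating_set ?n ?E ?D" unfolding dominating_set_nbrs using Dn by auto
      then show ?thesis using realizes_switch[OF real sw] cardD by blast
    next
      case False
      have "j' < ?n" using j k by simp
      then have "card (nbrs E j') > 0" using degree_sequence_pos[OF deg] real by (simp add: realizes_nbrs)
      then obtain x where x: "x \<in> nbrs E j'" by fastforce
      then have xk: "k \<le> x" "x < ?n" using notin nbrs_less[OF sg] by (meson not_le)+
      \<comment> \<open>The neighbours of \<open>j'\<close> now form a clique, so \<open>x\<close>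
        is adjacent to the others and to \<open>j'\<close>, \<open>j1\<close>, \<open>j2\<close>.
        Its degree exceeds that of \<open>j'\<close> although \<open>j' < k \<le> x\<close>.\<close>
      have "nbrs E j' - {x} \<union> {j', j1, j2} \<subseteq> nbrs E x"
        using False x adj[OF x] nbrs_sym by blast
      then have "card (nbrs E j' - {x} \<union> {j', j1, j2}) \<le> card (nbrs E x)"
        using fin by (intro card_mono)
      moreover have "card (nbrs E j' - {x} \<union> {j', j1, j2}) = card (nbrs E j' - {x}) + card {j', j1, j2}"
        using fin irr notin j by (intro card_Un_disjoint) auto
      moreover have "card {j', j1, j2} = 3" using j by auto
      moreover have "card (nbrs E j') \<le> card (nbrs E j' - {x}) + 1"
        using fin x by (simp add: card_Diff_singleton)
      ultimately have "card (nbrs E j') < card (nbrs E x)" by linarith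
      moreover have "card (nbrs E x) \<le> card (nbrs E j')"
        using degree_sequence_mono[OF deg, of j' x] j xk real by (simp add: realizes_nbrs)
      ultimately show ?thesis by simp
    qed
  qed
qed

lemma move:
  assumes deg: "degree_sequence d" and real: "realizes E d" and cov: "covered (length d) k E"
    and k: "k \<le> length d"
    and min: "\<forall>E D. realizes E d \<longrightarrow> dominating_set (length d) E D \<longrightarrow> k \<le> card D"
    and pz: "k \<le> p" "k \<le> z" and p: "card (nbrs E p \<inter> {..<k}) < k"
    and z: "2 \<le> card (nbrs E z \<inter> {..<k})" and less: "odeg k E z < odeg k E p"
  shows "\<exists>E'. realizes E' d \<and> covered (length d) k E' \<and>
    (\<forall>v\<ge>k. odeg k E' v = (if v = p then odeg k E p - 1 else if v = z then odeg k E z + 1 else odeg k E v))"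
proof -
  have sg: "simple_graph (length d) E" using real by (simp add: realizes_nbrs)
  obtain y where y: "k \<le> y" "y \<in> nbrs E p" "y \<notin> nbrs E z" "y \<noteq> z"
    using odeg_exchange[OF sg pz less] .
  show ?thesis
  proof (cases "\<exists>j<k. j \<in> nbrs E z \<and> j \<notin> nbrs E p")
    case True
    then show ?thesis using move_direct[OF real cov pz z _ _ _ y] by blast
  next
    case False
    have "\<not> {..<k} \<subseteq> nbrs E p"
    proof
      assume "{..<k} \<subseteq> nbrs E p"
      then have "nbrs E p \<inter> {..<k} = {..<k}" by blast
      then show False using p by simp
    qed
    then obtain j' where j': "j' < k" "j' \<notin> nbrs E p" by blast
    have j'z: "j' \<notin> nbrs E z" using False j' by blast
    obtain j1 j2 where j12: "j1 \<in> nbrs E z \<inter> {..<k}" "j2 \<in> nbrs E z \<inter> {..<k}" "j1 \<noteq> j2"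
    proof -
      have "\<not> card (nbrs E z \<inter> {..<k}) \<le> Suc 0" using z by simp
      then show ?thesis using that card_le_Suc0_iff_eq[of "nbrs E z \<inter> {..<k}"] by auto
    qed
    show ?thesis
    proof (cases "\<exists>j x. j < k \<and> j \<in> nbrs E z \<and> x \<in> nbrs E j' \<and> x \<notin> nbrs E j \<and> x \<noteq> j")
      case True
      then obtain j x where jx: "j < k" "j \<in> nbrs E z" "x \<in> nbrs E j'" "x \<notin> nbrs E j" "x \<noteq> j" by blast
      let ?E = "switch E z j j' x"
      note re = reroute_dominator[OF real cov jx(1) j'(1) pz(2) jx(2) j'z jx(3-5)]
      have "p \<noteq> z" using less by auto
      moreover have "p \<noteq> x" using j'(2) jx(3) nbrs_sym[of x E j'] by auto
      ultimately have nbp: "nbrs ?E p = nbrs E p" using re(6) pz by blast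
      have "y \<notin> nbrs ?E z" using re(7) y by auto
      moreover have "2 \<le> card (nbrs ?E z \<inter> {..<k})" using re(5) z by simp
      moreover have "j' \<notin> nbrs ?E p" "y \<in> nbrs ?E p" using nbp j' y by auto
      ultimately obtain E' where E': "realizes E' d" "covered (length d) k E'"
        "\<forall>v\<ge>k. odeg k E' v = (if v = p then odeg k ?E p - 1 else if v = z then odeg k ?E z + 1 else odeg k ?E v)"
        using move_direct[OF re(1,2) pz _ j'(1) re(4)] y(1,4) by blast
      have "\<forall>v\<ge>k. odeg k E' v = (if v = p then odeg k E p - 1 else if v = z then odeg k E z + 1 else odeg k E v)"
        using E'(3) re(3) pz by simp
      then show ?thesis using E'(1,2) by blast
    next
      case F2: False
      have "\<exists>E' D. realizes E' d \<and> dominating_set (length d) E' D \<and> card D < k"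
        using F2 j12 j' j'z by (intro superfluous_dominator[OF deg real cov k, of j1 j2 j']) auto
      then show ?thesis using min by (meson not_le)
    qed
  qed
qed

section \<open>Domination by the vertices of largest degree\<close>

lemma nbrs_transfer:
  assumes sg: "simple_graph n E" and A: "A \<subseteq> nbrs E j - nbrs E i" "i \<notin> A" and ij: "i \<noteq> j" "i < n"
  defines "E' \<equiv> (E - (\<lambda>w. {j, w}) ` A) \<union> (\<lambda>w. {i, w}) ` A"
  shows "simple_graph n E'"
    "nbrs E' i = nbrs E i \<union> A" "nbrs E' j = nbrs E j - A"
    "\<And>w. w \<noteq> i \<Longrightarrow> w \<noteq> j \<Longrightarrow> nbrs E' w = (if w \<in> A then insert i (nbrs E w - {j}) else nbrs E w)"
proof -
  have jA: "j \<notin> A" using A nbrs_irrefl[OF sg] by auto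
  show "simple_graph n E'"
    unfolding simple_graph_def E'_def
  proof safe
    fix e assume "e \<in> E"
    then show "\<exists>u v. e = {u, v} \<and> u < n \<and> v < n \<and> u \<noteq> v" using sg by (auto simp: simple_graph_def)
  next
    fix w assume "w \<in> A"
    then have "w < n" "w \<noteq> i" using A nbrs_less[OF sg] by blast+
    then show "\<exists>u v. {i, w} = {u, v} \<and> u < n \<and> v < n \<and> u \<noteq> v" using ij(2) by metis
  qed
  show "nbrs E' i = nbrs E i \<union> A" "nbrs E' j = nbrs E j - A"
    "\<And>w. w \<noteq> i \<Longrightarrow> w \<noteq> j \<Longrightarrow> nbrs E' w = (if w \<in> A then insert i (nbrs E w - {j}) else nbrs E w)"
    using ij A jA unfolding E'_def nbrs_def by (auto simp: doubleton_eq_iff image_iff insert_commute)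
qed

lemma nbrs_image:
  assumes "\<And>x. f (f x) = x"
  shows "nbrs ((`) f ` E) v = f ` nbrs E (f v)"
proof (rule set_eqI)
  have *: "f ` f ` X = X" for X using assms by (simp add: image_image)
  fix u
  have "u \<in> nbrs ((`) f ` E) v \<longleftrightarrow> (\<exists>e\<in>E. {u, v} = f ` e)"
    by (auto simp: nbrs_def)
  also have "\<dots> \<longleftrightarrow> f ` {u, v} \<in> E" using * by metis
  also have "\<dots> \<longleftrightarrow> f u \<in> nbrs E (f v)" by (simp add: nbrs_def)
  also have "\<dots> \<longleftrightarrow> u \<in> f ` nbrs E (f v)" using assms by (metis (no_types, lifting) imageE image_eqI)
  finally show "u \<in> nbrs ((`) f ` E) v \<longleftrightarrow> u \<in> f ` nbrs E (f v)" .
qed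

lemma simple_graph_image:
  assumes "simple_graph n E" "\<And>x. f (f x) = x" "\<And>x. x < n \<Longrightarrow> f x < n"
  shows "simple_graph n ((`) f ` E)"
  unfolding simple_graph_def
proof safe
  fix e assume "e \<in> E"
  then obtain u v where "e = {u, v}" "u < n" "v < n" "u \<noteq> v"
    using assms(1) unfolding simple_graph_def by blast
  then have "f ` e = {f u, f v} \<and> f u < n \<and> f v < n \<and> f u \<noteq> f v"
    using assms(2,3) by (metis image_empty image_insert)
  then show "\<exists>u v. f ` e = {u, v} \<and> u < n \<and> v < n \<and> u \<noteq> v" by blast
qed

text \<open>Transposing \<open>i\<close> and \<open>j\<close> makes the new set dominating but leaves \<open>i\<close> and \<open>j\<close> with
  exchanged degrees; the surplus edges at \<open>j\<close> are then handed to \<open>i\<close>, which can only spoil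
  the domination of \<open>j\<close> itself.\<close>

lemma exchange_dominator:
  assumes deg: "degree_sequence d" and real: "realizes E d" and dom: "dominating_set (length d) E D"
    and ij: "i < j" "j \<in> D" "i \<notin> D" and new: "\<not> (nbrs E j - {i} \<subseteq> nbrs E i \<and> i \<notin> nbrs E j \<and> nbrs E j \<inter> D = {})"
  shows "\<exists>E'. realizes E' d \<and> dominating_set (length d) E' (insert i (D - {j}))"
proof -
  let ?n = "length d" and ?D = "insert i (D - {j})"
  define f where "f x = (if x = i then j else if x = j then i else x)" for x
  have ff: "f (f x) = x" for x by (simp add: f_def)
  define E0 where "E0 = (`) f ` E"
  have Dn: "D \<subseteq> {..<?n}" and sg: "simple_graph ?n E"
    using dom real by (auto simp: dominating_set_nbrs realizes_nbrs)
  then have lt: "i < ?n" "j < ?n" using ij by auto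
  note irr = nbrs_irrefl[OF sg] and fin = finite_nbrs[OF sg]
  have nb: "nbrs E0 v = f ` nbrs E (f v)" for v
    unfolding E0_def by (rule nbrs_image) (rule ff)
  have mem: "u \<in> nbrs E0 v \<longleftrightarrow> f u \<in> nbrs E (f v)" for u v
    unfolding nb by (metis (no_types, lifting) ff imageE image_eqI)
  have sg0: "simple_graph ?n E0"
    unfolding E0_def using lt by (intro simple_graph_image[OF sg] ff) (auto simp: f_def)
  note irr0 = nbrs_irrefl[OF sg0] and fin0 = finite_nbrs[OF sg0]
  have card0: "card (nbrs E0 v) = card (nbrs E (f v))" for v
    unfolding nb by (rule card_image) (metis ff inj_on_def)
  have cards: "card (nbrs E0 i) = d ! j" "card (nbrs E0 j) = d ! i"
    using lt real ij by (auto simp: card0 realizes_nbrs f_def)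
  have fD: "f ` D = ?D" using ij by (auto simp: f_def image_iff)
  have dom0: "nbrs E0 v \<inter> ?D \<noteq> {}" if v: "v < ?n" "v \<notin> ?D" for v
  proof -
    have "f v < ?n" "f v \<notin> D" using v lt ij by (auto simp: f_def split: if_splits)
    then have "nbrs E (f v) \<inter> D \<noteq> {}" using dom by (auto simp: dominating_set_nbrs)
    then show ?thesis unfolding nb fD[symmetric] by blast
  qed
  have le: "d ! j \<le> d ! i" using degree_sequence_mono[OF deg] ij lt by simp
  have swapcard: "card (nbrs E0 i - {j}) + (d ! i - d ! j) = card (nbrs E0 j - {i})"
  proof (cases "i \<in> nbrs E0 j")
    case True
    then have "j \<in> nbrs E0 i" by (simp add: nbrs_sym)
    moreover then have "0 < card (nbrs E0 i)" using fin0 by (auto simp: card_gt_0_iff)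
    ultimately show ?thesis using True cards le by (simp add: card_Diff_singleton)
  next
    case False
    then have "j \<notin> nbrs E0 i" by (simp add: nbrs_sym)
    then show ?thesis using False cards le by simp
  qed
  let ?X = "nbrs E0 j - {i} - nbrs E0 i"
  have "card (nbrs E0 j - {i}) \<le> card (?X \<union> (nbrs E0 i - {j}))"
    using fin0 irr0 by (intro card_mono) auto
  also have "\<dots> \<le> card ?X + card (nbrs E0 i - {j})" by (rule card_Un_le)
  finally have X: "d ! i - d ! j \<le> card ?X" using swapcard by linarith
  \<comment> \<open>The neighbours handed over may be any \<open>d ! i - d ! j\<close> elements of
    \<open>?X\<close>, but \<open>j\<close> must retain a neighbour in \<open>?D\<close>.\<close>
  have "\<exists>A\<subseteq>?X. card A = d ! i - d ! j \<and> nbrs E0 j \<inter> ?D - A \<noteq> {}"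
  proof (cases "\<exists>y\<in>nbrs E0 j \<inter> ?D. y \<notin> ?X")
    case True
    obtain A where "A \<subseteq> ?X" "card A = d ! i - d ! j" using obtain_subset_with_card_n[OF X] by metis
    then show ?thesis using True by (intro exI[of _ A]) blast
  next
    case False
    show ?thesis
    proof (cases "card ?X = d ! i - d ! j")
      case True
      \<comment> \<open>Here \<open>A\<close> would have to be all of \<open>?X\<close>. Counting
        puts the neighbours of \<open>i\<close> in \<open>E0\<close>, apart from \<open>j\<close>,
        among those of \<open>j\<close>; undoing the transposition gives the very configuration that
        \<open>new\<close> excludes.\<close>
      have "card (nbrs E0 i - {j} \<union> ?X) = card (nbrs E0 i - {j}) + card ?X"
        using fin0 by (intro card_Un_disjoint) auto
      also have "\<dots> = card (nbrs E0 j - {i})" using True swapcard by simp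
      finally have c: "card (nbrs E0 i - {j} \<union> ?X) = card (nbrs E0 j - {i})" .
      have "nbrs E0 j - {i} = nbrs E0 i - {j} \<union> ?X"
        using fin0 irr0 by (intro card_subset_eq[OF _ _ c[symmetric]]) auto
      then have sub: "nbrs E0 i - {j} \<subseteq> nbrs E0 j" by blast
      have "i \<notin> nbrs E0 j" using False by blast
      then have 1: "i \<notin> nbrs E j" using nbrs_sym[of i E j] ij by (simp add: mem f_def)
      have mem': "w \<in> nbrs E0 i \<longleftrightarrow> w \<in> nbrs E j" "w \<in> nbrs E0 j \<longleftrightarrow> w \<in> nbrs E i"
        if "w \<noteq> i" "w \<noteq> j" for w
        using that ij by (auto simp: mem f_def)
      have 2: "nbrs E j - {i} \<subseteq> nbrs E i"
      proof
        fix w assume w: "w \<in> nbrs E j - {i}"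
        then have wij: "w \<noteq> i" "w \<noteq> j" using irr by auto
        then show "w \<in> nbrs E i" using mem' sub w by blast
      qed
      have "nbrs E j \<inter> D = {}"
      proof (rule ccontr)
        assume "nbrs E j \<inter> D \<noteq> {}"
        then obtain w where w: "w \<in> nbrs E j" "w \<in> D" by blast
        then have wij: "w \<noteq> i" "w \<noteq> j" using irr ij by auto
        then have "w \<in> nbrs E0 j" "w \<in> nbrs E0 i" using mem' 2 w by blast+
        then show False using False w wij by blast
      qed
      then show ?thesis using new 1 2 by blast
    next
      case F: False
      have "j \<notin> ?D" "j < ?n" using ij lt by auto
      then obtain y where y: "y \<in> nbrs E0 j" "y \<in> ?D" using dom0 by blast
      then have "y \<in> ?X" using False by blast
      \<comment> \<open>\<open>?X\<close> has an element to spare, so \<open>y\<close> can be left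
        out of \<open>A\<close>.\<close>
      then have "d ! i - d ! j \<le> card (?X - {y})" using F X fin0 by (simp add: card_Diff_singleton)
      then obtain A where "A \<subseteq> ?X - {y}" "card A = d ! i - d ! j"
        using obtain_subset_with_card_n by metis
      then show ?thesis using y by (intro exI[of _ A]) blast
    qed
  qed
  then obtain A where A: "A \<subseteq> ?X" "card A = d ! i - d ! j" "nbrs E0 j \<inter> ?D - A \<noteq> {}"
    by (elim exE conjE)
  have "nbrs E0 j \<inter> ?D - A = (nbrs E0 j - A) \<inter> ?D" by blast
  then have keep: "(nbrs E0 j - A) \<inter> ?D \<noteq> {}" using A(3) by simp
  let ?E = "(E0 - (\<lambda>w. {j, w}) ` A) \<union> (\<lambda>w. {i, w}) ` A"
  have jA: "j \<notin> A" "i \<notin> A" using A irr0 by auto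
  have "A \<subseteq> nbrs E0 j - nbrs E0 i" using A(1) by blast
  note tr = nbrs_transfer[OF sg0 this jA(2) _ lt(1)]
  have ne: "i \<noteq> j" using ij by simp
  have finA: "finite A" using A(1) fin0 by (meson finite_Diff finite_subset)
  have "card (nbrs ?E v) = d ! v" if "v < ?n" for v
  proof -
    consider "v = i" | "v = j" | "v \<noteq> i" "v \<noteq> j" "v \<in> A" | "v \<noteq> i" "v \<noteq> j" "v \<notin> A" by blast
    then show ?thesis
    proof cases
      case 1
      have "card (nbrs E0 i \<union> A) = card (nbrs E0 i) + card A"
        using A finA fin0 by (intro card_Un_disjoint) auto
      then show ?thesis using 1 tr(2)[OF ne] cards A le by simp
    next
      case 2
      have "card (nbrs E0 j - A) = card (nbrs E0 j) - card A"
        using A finA by (intro card_Diff_subset) auto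
      then show ?thesis using 2 tr(3)[OF ne] cards A le by simp
    next
      case 3
      then have "card (nbrs ?E v) = card (nbrs E0 v)"
        using tr(4)[OF ne] A fin0 nbrs_sym[of v E0] card_insert_Diff[of "nbrs E0 v" j i]
        by (auto simp del: card_insert_disjoint)
      then show ?thesis using 3 that real by (simp add: card0 realizes_nbrs f_def)
    next
      case 4
      then have "card (nbrs ?E v) = card (nbrs E0 v)" using tr(4)[OF ne] by simp
      then show ?thesis using 4 that real by (simp add: card0 realizes_nbrs f_def)
    qed
  qed
  then have rE: "realizes ?E d" using tr(1)[OF ne] by (simp add: realizes_nbrs)
  have "nbrs ?E v \<inter> ?D \<noteq> {}" if v: "v < ?n" "v \<notin> ?D" for v
  proof -
    consider "v = j" | "v \<noteq> i" "v \<noteq> j" "v \<in> A" | "v \<noteq> i" "v \<noteq> j" "v \<notin> A" using v by blast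
    then show ?thesis
    proof cases
      case 1
      show ?thesis unfolding 1 tr(3)[OF ne] by (rule keep)
    next
      case 2
      have "i \<in> nbrs ?E v" unfolding tr(4)[OF ne 2(1,2)] using 2(3) by simp
      then show ?thesis by blast
    next
      case 3
      have "nbrs ?E v = nbrs E0 v" unfolding tr(4)[OF ne 3(1,2)] using 3(3) by simp
      then show ?thesis using dom0[OF v] by simp
    qed
  qed
  moreover have "?D \<subseteq> {..<?n}" using Dn lt by auto
  ultimately have "dominating_set ?n ?E ?D" unfolding dominating_set_nbrs by blast
  with rE show ?thesis by (intro exI conjI)
qed

text \<open>\<open>exchange_dominator\<close> leaves the case that all neighbours of
  \<open>j\<close> are neighbours of \<open>i\<close>, that \<open>i\<close> and \<open>j\<close>
  are not adjacent, and that \<open>D\<close> has no neighbour of \<open>j\<close>. Then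
  \<open>i\<close> can replace \<open>j\<close>, except that \<open>j\<close> itself lacks a
  dominator. Two switches that join \<open>j\<close> to \<open>i\<close> are considered; if neither
  exists, a neighbour of \<open>j\<close> takes its place, whence \<open>i'\<close> instead of
  \<open>i\<close>.\<close>

lemma improve_dominating_set:
  assumes deg: "degree_sequence d" and real: "realizes E d" and dom: "dominating_set (length d) E D"
    and ij: "i < j" "j \<in> D" "i \<notin> D"
  shows "\<exists>E' i'. i' < j \<and> i' \<notin> D \<and> realizes E' d \<and> dominating_set (length d) E' (insert i' (D - {j}))"
proof (cases "nbrs E j - {i} \<subseteq> nbrs E i \<and> i \<notin> nbrs E j \<and> nbrs E j \<inter> D = {}")
  case False
  then show ?thesis using exchange_dominator[OF deg real dom ij] ij by blast
next
  case True
  let ?n = "length d" and ?D = "insert i (D - {j})"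
  have Dn: "D \<subseteq> {..<?n}" and sg: "simple_graph ?n E"
    using dom real by (auto simp: dominating_set_nbrs realizes_nbrs)
  then have lt: "i < ?n" "j < ?n" using ij by auto
  note irr = nbrs_irrefl[OF sg] and fin = finite_nbrs[OF sg]
  have sub: "nbrs E j \<subseteq> nbrs E i" and nij: "i \<notin> nbrs E j" "j \<notin> nbrs E i" and nD: "nbrs E j \<inter> D = {}"
    using True nbrs_sym[of i E j] by auto
  obtain y where y: "y \<in> nbrs E i" "y \<in> D" "y \<noteq> j"
    using dom lt ij nij unfolding dominating_set_nbrs by blast
  have domv: "nbrs E v \<inter> ?D \<noteq> {}" if "v < ?n" "v \<notin> ?D" "v \<noteq> j" for v
  proof -
    have "nbrs E v \<inter> D \<noteq> {}" using dom that by (auto simp: dominating_set_nbrs)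
    then show ?thesis using sub nbrs_sym[of _ E v] by blast
  qed
  have yj: "y \<notin> nbrs E j" and yi: "y \<noteq> i" using nD y ij by auto
  show ?thesis
  proof (cases "\<exists>z\<in>nbrs E j. z \<notin> nbrs E y")
    case True
    then obtain z where z: "z \<in> nbrs E j" "z \<notin> nbrs E y" by blast
    have zz: "z \<in> nbrs E i" "z \<noteq> j" "z \<noteq> i" "z \<noteq> y" "z \<notin> D" using z sub irr nij yj nD by auto
    \<comment> \<open>\<open>j\<close> trades \<open>z\<close> for \<open>i\<close>;
      \<open>z\<close> keeps \<open>i\<close>, and \<open>y\<close>, which loses \<open>i\<close>,
      belongs to \<open>?D\<close>.\<close>
    have sw: "switchable E j z i y"
      unfolding switchable_def using z zz y yj yi ij nij nbrs_sym[of y E z] by auto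
    let ?E = "switch E j z i y"
    note nb = nbrs_switch[OF sw]
    have "nbrs ?E v \<inter> ?D \<noteq> {}" if v: "v < ?n" "v \<notin> ?D" for v
    proof -
      consider "v = j" | "v = z" | "v \<notin> {i, j, y, z}" using v y by auto
      then show ?thesis
      proof cases
        case 1
        then show ?thesis by (simp add: nb)
      next
        case 2
        have "i \<in> nbrs E z" using zz(1) nbrs_sym by blast
        then show ?thesis using 2 zz ij y yi by (auto simp: nb)
      next
        case 3
        then show ?thesis using domv[OF v] by (simp add: nb)
      qed
    qed
    then have "dominating_set ?n ?E ?D" unfolding dominating_set_nbrs using Dn lt by auto
    then show ?thesis using realizes_switch[OF real sw] ij by blast
  next
    case F: False
    show ?thesis
    proof (cases "\<exists>z z'. z \<in> nbrs E j \<and> z' \<in> nbrs E j \<and> z \<noteq> z' \<and> z \<notin> nbrs E z'")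
      case True
      then obtain z z' where z: "z \<in> nbrs E j" "z' \<in> nbrs E j" "z \<noteq> z'" "z \<notin> nbrs E z'" by blast
      have zz: "z \<in> nbrs E i" "z \<noteq> j" "z \<noteq> i" "z' \<in> nbrs E i" "z' \<noteq> j" "z' \<noteq> i" "z \<notin> D" "z' \<notin> D"
        using z sub irr nij nD by auto
      \<comment> \<open>\<open>j\<close> trades \<open>z\<close> for \<open>i\<close>;
        \<open>z\<close> keeps \<open>i\<close>, and \<open>z'\<close>, which loses
        \<open>i\<close>, still has \<open>y\<close>.\<close>
      have sw: "switchable E j z i z'"
        unfolding switchable_def using z zz ij nij nbrs_sym[of z E z'] by auto
      let ?E = "switch E j z i z'"
      note nb = nbrs_switch[OF sw]
      have "nbrs ?E v \<inter> ?D \<noteq> {}" if v: "v < ?n" "v \<notin> ?D" for v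
      proof -
        consider "v = j" | "v = z" | "v = z'" | "v \<notin> {i, j, z, z'}" using v by auto
        then show ?thesis
        proof cases
          case 1
          then show ?thesis by (simp add: nb)
        next
          case 2
          have "i \<in> nbrs E z" using zz(1) nbrs_sym by blast
          then show ?thesis using 2 zz ij z by (auto simp: nb)
        next
          case 3
          have "y \<in> nbrs E z'" using z F nbrs_sym by blast
          then show ?thesis using 3 zz z y yi by (auto simp: nb)
        next
          case 4
          then show ?thesis using domv[OF v] by (simp add: nb)
        qed
      qed
      then have "dominating_set ?n ?E ?D" unfolding dominating_set_nbrs using Dn lt by auto
      then show ?thesis using realizes_switch[OF real sw] ij by blast
    next
      case clique: False
      have "card (nbrs E j) > 0" using degree_sequence_pos[OF deg] real lt by (simp add: realizes_nbrs)
      then obtain z where z: "z \<in> nbrs E j" by fastforce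
      have zn: "z < ?n" using z nbrs_less[OF sg] by blast
      \<comment> \<open>\<open>z\<close> is adjacent to the other neighbours of \<open>j\<close> and
        to \<open>j\<close>, \<open>i\<close>, \<open>y\<close>; its larger degree places it before
        \<open>j\<close>. In the unchanged graph \<open>z\<close> then replaces \<open>j\<close>: it
        dominates \<open>j\<close>, and the neighbours of \<open>j\<close> have
        \<open>y\<close>.\<close>
      have "nbrs E j - {z} \<union> {j, i, y} \<subseteq> nbrs E z"
        using clique z sub F nbrs_sym by blast
      then have "card (nbrs E j - {z} \<union> {j, i, y}) \<le> card (nbrs E z)"
        using fin by (intro card_mono)
      moreover have "card (nbrs E j - {z} \<union> {j, i, y}) = card (nbrs E j - {z}) + card {j, i, y}"
        using fin irr nij yj by (intro card_Un_disjoint) auto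
      moreover have "card {j, i, y} = 3" using ij y yi by auto
      moreover have "card (nbrs E j) \<le> card (nbrs E j - {z}) + 1"
        using fin z by (simp add: card_Diff_singleton)
      ultimately have "card (nbrs E j) < card (nbrs E z)" by linarith
      then have "z < j"
        using degree_sequence_mono[OF deg, of j z] zn lt real by (fastforce simp: realizes_nbrs not_less)
      have "nbrs E v \<inter> insert z (D - {j}) \<noteq> {}" if v: "v < ?n" "v \<notin> insert z (D - {j})" for v
      proof (cases "v = j")
        case True
        then show ?thesis using z by blast
      next
        case vj: False
        then have ne: "nbrs E v \<inter> D \<noteq> {}" using dom v by (auto simp: dominating_set_nbrs)
        show ?thesis
        proof (cases "j \<in> nbrs E v")
          case True
          then have "v \<in> nbrs E j" by (simp add: nbrs_sym)
          then have "y \<in> nbrs E v" using F nbrs_sym by blast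
          then show ?thesis using y by blast
        next
          case False
          then show ?thesis using ne by blast
        qed
      qed
      then have "dominating_set ?n E (insert z (D - {j}))"
        unfolding dominating_set_nbrs using Dn zn by auto
      moreover have "z \<notin> D" using z nD by blast
      ultimately show ?thesis using \<open>z < j\<close> real by blast
    qed
  qed
qed

text \<open>The sum of the elements of \<open>D\<close> is the potential. Unless \<open>D\<close> is
  an initial segment, it has a member that is at least \<open>card D\<close> and lacks an index
  below \<open>card D\<close>. An exchange then lowers the sum at equal size, at the price of
  changing the graph.\<close>

lemma covered_of_dominating_set:
  assumes deg: "degree_sequence d" and real: "realizes E d" and dom: "dominating_set (length d) E D"
  shows "\<exists>E'. realizes E' d \<and> covered (length d) (card D) E'"
  using real dom
proof (induction "\<Sum>D" arbitrary: E D rule: less_induct)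
  case less
  have fin: "finite D" using less.prems(2) by (meson dominating_set_def finite_lessThan finite_subset)
  have D: "D \<subseteq> {..<length d}" using less.prems(2) by (simp add: dominating_set_def)
  then have le: "card D \<le> length d" using card_mono[of "{..<length d}" D] by simp
  show ?case
  proof (cases "D = {..<card D}")
    case True
    then show ?thesis using less.prems covered_iff_dominating_set[OF le] by metis
  next
    case False
    have "\<not> D \<subseteq> {..<card D}" using False card_subset_eq[of "{..<card D}" D] by auto
    then obtain j where j: "j \<in> D" "card D \<le> j" by (meson lessThan_iff not_le subsetI)
    have "\<not> {..<card D} \<subseteq> D" using False card_subset_eq[OF fin, of "{..<card D}"] by auto
    then obtain i where i: "i < card D" "i \<notin> D" by blast
    have "i < j" using i j by simp
    then obtain E' i' where E': "i' < j" "i' \<notin> D" "realizes E' d" "dominating_set (length d) E' (insert i' (D - {j}))"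
      using improve_dominating_set[OF deg less.prems _ j(1) i(2)] by blast
    have "\<Sum>(insert i' (D - {j})) = i' + \<Sum>(D - {j})" using fin E'(2) by simp
    also have "\<dots> < j + \<Sum>(D - {j})" using E'(1) by simp
    also have "\<dots> = \<Sum>D" using fin j(1) by (simp add: sum.remove)
    finally have "\<exists>E''. realizes E'' d \<and> covered (length d) (card (insert i' (D - {j}))) E''"
      using less.hyps E'(3,4) by blast
    moreover have "card (insert i' (D - {j})) = card D" using fin j(1) E'(2) by (rule card_insert_Diff)
    ultimately show ?thesis by simp
  qed
qed

section \<open>Levelling the outside degrees\<close>

definition target :: "nat list \<Rightarrow> nat \<Rightarrow> nat \<Rightarrow> nat \<Rightarrow> nat \<Rightarrow> nat" where
  "target d k M r v = max (d ! v - k) (min (d ! v - 1) (M + (if v < r then 1 else 0)))"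

lemma odeg_bounds:
  assumes "realizes E d" "covered (length d) k E" "k \<le> v" "v < length d"
  shows "d ! v - k \<le> odeg k E v" "odeg k E v < d ! v" "card (nbrs E v \<inter> {..<k}) + odeg k E v = d ! v"
proof -
  have sg: "simple_graph (length d) E" and dv: "card (nbrs E v) = d ! v"
    using assms by (auto simp: realizes_nbrs)
  show eq: "card (nbrs E v \<inter> {..<k}) + odeg k E v = d ! v"
    using odeg_card_nbrs[OF sg, of v k] dv by simp
  have "card (nbrs E v \<inter> {..<k}) \<le> card {..<k}" by (rule card_mono) auto
  then show "d ! v - k \<le> odeg k E v" using eq by simp
  have "card (nbrs E v \<inter> {..<k}) > 0"
    using assms finite_nbrs[OF sg] by (auto simp: covered_def card_gt_0_iff)
  then show "odeg k E v < d ! v" using eq by simp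
qed

text \<open>The measure is the distance to the target. Equal sums provide \<open>p\<close> above its
  target and \<open>z\<close> below it. Clamping causes neither, since actual outside degrees obey
  the bounds; so \<open>p\<close> lies above its level and \<open>z\<close> below its own. Levels
  differ by at most one, hence \<open>odeg k E z < odeg k E p\<close> and \<open>move\<close>
  applies.\<close>

lemma balance:
  fixes M r :: nat
  assumes deg: "degree_sequence d" and k: "k \<le> length d"
    and min: "\<forall>E D. realizes E d \<longrightarrow> dominating_set (length d) E D \<longrightarrow> k \<le> card D"
    and E: "realizes E d" "covered (length d) k E"
      "(\<Sum>v\<in>{k..<length d}. odeg k E v) = (\<Sum>v\<in>{k..<length d}. target d k M r v)"
  shows "\<exists>E. realizes E d \<and> covered (length d) k E \<and> (\<forall>v\<in>{k..<length d}. odeg k E v = target d k M r v)"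
  using E
proof (induction "\<Sum>v\<in>{k..<length d}. (odeg k E v - target d k M r v) + (target d k M r v - odeg k E v)"
    arbitrary: E rule: less_induct)
  case less
  let ?I = "{k..<length d}" and ?g = "target d k M r"
  show ?case
  proof (cases "\<forall>v\<in>?I. odeg k E v = ?g v")
    case True
    then show ?thesis using less.prems by blast
  next
    case False
    have p_ex: "\<exists>p\<in>?I. ?g p < odeg k E p"
    proof (rule ccontr)
      assume "\<not> ?thesis"
      then have le: "\<And>v. v \<in> ?I \<Longrightarrow> odeg k E v \<le> ?g v" by (meson not_le)
      have "\<exists>v\<in>?I. odeg k E v < ?g v" using False le by (metis le_neq_implies_less)
      then have "(\<Sum>v\<in>?I. odeg k E v) < (\<Sum>v\<in>?I. ?g v)"
        using le by (intro sum_strict_mono_ex1) auto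
      then show False using less.prems by simp
    qed
    have z_ex: "\<exists>z\<in>?I. odeg k E z < ?g z"
    proof (rule ccontr)
      assume "\<not> ?thesis"
      then have le: "\<And>v. v \<in> ?I \<Longrightarrow> ?g v \<le> odeg k E v" by (meson not_le)
      then have "(\<Sum>v\<in>?I. ?g v) < (\<Sum>v\<in>?I. odeg k E v)"
        using p_ex by (intro sum_strict_mono_ex1) auto
      then show False using less.prems by simp
    qed
    obtain p z where pz: "p \<in> ?I" "?g p < odeg k E p" "z \<in> ?I" "odeg k E z < ?g z"
      using p_ex z_ex by blast
    have bp: "d ! p - k \<le> ?g p" "odeg k E p < d ! p" "card (nbrs E p \<inter> {..<k}) + odeg k E p = d ! p"
      using odeg_bounds[OF less.prems(1,2), of p] pz by (auto simp: target_def)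
    have bz: "d ! z - k \<le> odeg k E z" "odeg k E z < d ! z" "card (nbrs E z \<inter> {..<k}) + odeg k E z = d ! z"
      using odeg_bounds[OF less.prems(1,2), of z] pz by auto
    have gz: "odeg k E z < min (d ! z - 1) (M + (if z < r then 1 else 0))"
      using pz(4) bz(1) unfolding target_def by (metis leD less_max_iff_disj)
    have "min (d ! p - 1) (M + (if p < r then 1 else 0)) < odeg k E p"
      using pz(2) unfolding target_def by simp
    then have "M + (if p < r then 1 else 0) < odeg k E p"
      using bp(2) by (auto simp: min_less_iff_disj simp del: One_nat_def)
    then have "M < odeg k E p" by simp
    moreover have "odeg k E z < M + (if z < r then 1 else 0)" using gz by simp
    then have "odeg k E z \<le> M" by (simp split: if_splits)
    ultimately have "odeg k E z < odeg k E p" by simp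
    \<comment> \<open>The lower clamp at \<open>p\<close> leaves a core vertex that \<open>p\<close>
      lacks; the upper clamp at \<open>z\<close> leaves a core neighbour to give up.\<close>
    moreover have "card (nbrs E p \<inter> {..<k}) < k" using bp pz(2) by linarith
    moreover have "odeg k E z < d ! z - 1" using gz by simp
    then have "2 \<le> card (nbrs E z \<inter> {..<k})" using bz by linarith
    moreover have "k \<le> p" "k \<le> z" using pz by auto
    ultimately obtain E' where E': "realizes E' d" "covered (length d) k E'" and
      od: "\<forall>v\<ge>k. odeg k E' v = (if v = p then odeg k E p - 1 else if v = z then odeg k E z + 1 else odeg k E v)"
      using move[OF deg less.prems(1,2) k min] by blast
    have ne: "p \<noteq> z" using pz by auto
    have "(\<Sum>v\<in>?I. odeg k E' v) + 1 = (\<Sum>v\<in>?I. odeg k E' v + (if v = p then 1 else 0))"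
      using pz by (simp add: sum.distrib)
    also have "\<dots> = (\<Sum>v\<in>?I. odeg k E v + (if v = z then 1 else 0))"
      using od pz ne by (intro sum.cong) auto
    also have "\<dots> = (\<Sum>v\<in>?I. odeg k E v) + 1"
      using pz by (simp add: sum.distrib)
    finally have "(\<Sum>v\<in>?I. odeg k E' v) = (\<Sum>v\<in>?I. ?g v)" using less.prems(3) by simp
    moreover have "(\<Sum>v\<in>?I. (odeg k E' v - ?g v) + (?g v - odeg k E' v)) < (\<Sum>v\<in>?I. (odeg k E v - ?g v) + (?g v - odeg k E v))"
      using od pz ne by (intro sum_strict_mono_ex1 bexI[of _ p]) auto
    ultimately show ?thesis using less.hyps E' by blast
  qed
qed

section \<open>The chain of targets and its sums\<close>

lemma discrete_intermediate_value:
  fixes h :: "nat \<Rightarrow> nat"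
  assumes "\<And>T. h (Suc T) \<le> h T + 1" "h 0 \<le> S" "S \<le> h N"
  obtains T where "T \<le> N" "h T = S"
proof -
  let ?T = "LEAST T. S \<le> h T"
  have T: "S \<le> h ?T" "?T \<le> N" using assms(3) by (auto intro: LeastI Least_le)
  have "h ?T = S"
  proof (cases ?T)
    case 0
    then show ?thesis using T assms(2) by simp
  next
    case (Suc T)
    then have "h T < S" using not_less_Least[of T "\<lambda>T. S \<le> h T"] by simp
    then show ?thesis using T Suc assms(1)[of T] by simp
  qed
  then show ?thesis using that T by blast
qed

text \<open>With \<open>T = M * n + r\<close>, one step of \<open>T\<close> raises the level at the
  single vertex \<open>T mod n\<close>. When \<open>r\<close> wraps from \<open>n - 1\<close> to 0,
  the increase of \<open>M\<close> makes up for the increments that are lost.\<close>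

lemma threshold_Suc:
  assumes "v < (n::nat)"
  shows "Suc T div n + (if v < Suc T mod n then 1 else 0) =
    T div n + (if v < T mod n then 1 else 0) + (if v = T mod n then 1 else 0)"
proof -
  have "T mod n < n" using assms by simp
  then show ?thesis using assms by (auto simp: div_Suc mod_Suc)
qed

lemma target_Suc:
  assumes "v < n"
  shows "target d k (Suc T div n) (Suc T mod n) v \<le> target d k (T div n) (T mod n) v + (if v = T mod n then 1 else 0)"
  unfolding target_def threshold_Suc[OF assms] by auto

lemma exists_target_realization:
  assumes deg: "degree_sequence d" and k: "k \<le> length d"
    and min: "\<forall>E D. realizes E d \<longrightarrow> dominating_set (length d) E D \<longrightarrow> k \<le> card D"
    and E: "realizes E d" "covered (length d) k E" and n: "0 < length d"
  shows "\<exists>M<length d. \<exists>r<length d. \<exists>E. realizes E d \<and> (\<forall>v\<in>{k..<length d}. odeg k E v = target d k M r v)"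
proof -
  let ?n = "length d" and ?I = "{k..<length d}"
  let ?h = "\<lambda>T. \<Sum>v\<in>?I. target d k (T div ?n) (T mod ?n) v"
  have step: "?h (Suc T) \<le> ?h T + 1" for T
  proof -
    have "?h (Suc T) \<le> (\<Sum>v\<in>?I. target d k (T div ?n) (T mod ?n) v + (if v = T mod ?n then 1 else 0))"
      by (intro sum_mono target_Suc) simp
    also have "\<dots> \<le> ?h T + 1" unfolding sum.distrib by simp
    finally show ?thesis .
  qed
  have sg: "simple_graph ?n E" using E by (simp add: realizes_nbrs)
  have "d ! v \<le> ?n - 1" if "v < ?n" for v
  proof -
    have "card (nbrs E v) \<le> card ({..<?n} - {v})" by (intro card_mono nbrs_subset[OF sg]) simp
    then show ?thesis using E that by (simp add: realizes_nbrs)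
  qed
  \<comment> \<open>Here the level is \<open>?n - 1\<close> with \<open>r = 0\<close>, and no degree
    exceeds \<open>?n - 1\<close>, so the chain ends at or above the upper bounds.\<close>
  then have max: "target d k (?n * (?n - 1) div ?n) (?n * (?n - 1) mod ?n) v \<ge> d ! v - 1" if "v \<in> ?I" for v
    using that n by (fastforce simp: target_def)
  \<comment> \<open>\<open>T = 0\<close> gives \<open>M = r = 0\<close>, so only the lower bounds
    remain.\<close>
  have "?h 0 \<le> (\<Sum>v\<in>?I. odeg k E v)"
    using odeg_bounds(1)[OF E] by (intro sum_mono) (auto simp: target_def)
  moreover have "odeg k E v \<le> target d k (?n * (?n - 1) div ?n) (?n * (?n - 1) mod ?n) v" if "v \<in> ?I" for v
    using odeg_bounds(2)[OF E, of v] max[OF that] that by fastforce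
  then have "(\<Sum>v\<in>?I. odeg k E v) \<le> ?h (?n * (?n - 1))" by (rule sum_mono)
  ultimately obtain T where T: "T \<le> ?n * (?n - 1)" "?h T = (\<Sum>v\<in>?I. odeg k E v)"
    using discrete_intermediate_value[of ?h, OF step] by blast
  obtain E' where "realizes E' d" "\<forall>v\<in>?I. odeg k E' v = target d k (T div ?n) (T mod ?n) v"
    using balance[OF deg k min E T(2)[symmetric]] by blast
  moreover have "T mod ?n < ?n" using n by simp
  moreover have "T div ?n < ?n"
    using T(1) n by (metis Suc_diff_1 div_le_mono le_imp_less_Suc less_numeral_extra(3) nonzero_mult_div_cancel_left)
  ultimately show ?thesis by blast
qed

section \<open>Greedy realization\<close>

text \<open>One shape for both passes: \<open>lo = 0\<close>, \<open>hi = k\<close> describes the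
  edges that meet the core, \<open>lo = k\<close>, \<open>hi = n\<close> those that avoid it. The
  bound \<open>m\<close> on the larger endpoint shrinks as vertices are finished.\<close>

definition allowed :: "nat \<Rightarrow> nat \<Rightarrow> nat \<Rightarrow> nat set set" where
  "allowed lo hi m = {{u, w} | u w. lo \<le> u \<and> u < hi \<and> u < w \<and> w < m}"

lemma allowed_edge:
  "{a, b} \<in> allowed lo hi m \<longleftrightarrow> a \<noteq> b \<and> lo \<le> min a b \<and> min a b < hi \<and> max a b < m"
proof
  assume "{a, b} \<in> allowed lo hi m"
  then show "a \<noteq> b \<and> lo \<le> min a b \<and> min a b < hi \<and> max a b < m"
    unfolding allowed_def by (auto simp: doubleton_eq_iff)
next
  assume *: "a \<noteq> b \<and> lo \<le> min a b \<and> min a b < hi \<and> max a b < m"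
  have "{a, b} = {min a b, max a b}" by (auto simp: min_def max_def)
  moreover have "min a b < max a b" using * by (auto simp: min_def max_def)
  ultimately show "{a, b} \<in> allowed lo hi m" unfolding allowed_def using * by blast
qed

lemma allowed_cases:
  assumes "e \<in> allowed lo hi m" obtains u w where "e = {u, w}" "lo \<le> u" "u < hi" "u < w" "w < m"
  using assms unfolding allowed_def by blast

lemma simple_graph_allowed:
  assumes "m \<le> n" "E \<subseteq> allowed lo hi m"
  shows "simple_graph n E"
  unfolding simple_graph_def
proof
  fix e assume "e \<in> E"
  then have "e \<in> allowed lo hi m" using assms(2) by blast
  then obtain u w where "e = {u, w}" "u < w" "w < m" by (rule allowed_cases)
  then have "e = {u, w} \<and> u < n \<and> w < n \<and> u \<noteq> w" using assms(1) by simp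
  then show "e \<in> {{u, v} | u v. u < n \<and> v < n \<and> u \<noteq> v}" by blast
qed

lemma nbrs_allowed: "H \<subseteq> allowed lo hi m \<Longrightarrow> u \<in> nbrs H v \<Longrightarrow> {u, v} \<in> allowed lo hi m"
  by (auto simp: nbrs_def)

lemma allowed_mono: "m \<le> m' \<Longrightarrow> allowed lo hi m \<subseteq> allowed lo hi m'"
  unfolding allowed_def using less_le_trans by blast

text \<open>The exchange step of Havel and Hakimi for a single neighbour. If \<open>v\<close> is
  joined to some \<open>j\<close> but not to \<open>u\<close>, then \<open>u\<close>, whose degree
  is no smaller than that of \<open>j\<close>, has a neighbour \<open>x\<close> that
  \<open>j\<close> lacks, and a switch puts \<open>u\<close> in the place of
  \<open>j\<close>.\<close>

lemma max_residual_neighbour: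
  assumes H: "H \<subseteq> allowed lo hi (Suc v)" and u: "lo \<le> u" "u < hi" "u < v" "\<not> marked u"
    and nonempty: "nbrs H v \<noteq> {}" and unmarked: "\<forall>w\<in>nbrs H v. \<not> marked w"
    and max: "\<And>w. lo \<le> w \<Longrightarrow> w < hi \<Longrightarrow> w < v \<Longrightarrow> \<not> marked w \<Longrightarrow> card (nbrs H w) \<le> card (nbrs H u)"
  shows "\<exists>H'. H' \<subseteq> allowed lo hi (Suc v) \<and> (\<forall>w. card (nbrs H' w) = card (nbrs H w)) \<and>
    u \<in> nbrs H' v \<and> (\<forall>w\<in>nbrs H' v. \<not> marked w)"
proof (cases "u \<in> nbrs H v")
  case True
  then show ?thesis using H unmarked by blast
next
  case False
  have sg: "simple_graph (Suc v) H" using simple_graph_allowed[OF _ H] by simp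
  obtain j where j: "j \<in> nbrs H v" using nonempty by blast
  have "{j, v} \<in> allowed lo hi (Suc v)" using nbrs_allowed[OF H j] .
  then have jl: "lo \<le> j" "j < hi" "j < v" unfolding allowed_edge by auto
  have vu: "v \<notin> nbrs H u" "v \<in> nbrs H j" using False j nbrs_sym by blast+
  have "card (nbrs H j) \<le> card (nbrs H u)" using max jl unmarked j by blast
  then obtain x where x: "x \<in> nbrs H u" "x \<notin> nbrs H j" "x \<noteq> j"
    using nbrs_exchange[OF sg _ vu(2,1)] u(3) by blast
  have xu: "x \<noteq> u" "x \<noteq> v" using x nbrs_irrefl[OF sg] vu by auto
  have sw: "switchable H v j u x"
    unfolding switchable_def using False j x jl u xu nbrs_sym[of x H j] by auto
  let ?H = "switch H v j u x"
  have nbv: "nbrs ?H v = insert u (nbrs H v - {j})" using nbrs_switch[OF sw, of v] by simp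
  have "{x, u} \<in> allowed lo hi (Suc v)" using nbrs_allowed[OF H x(1)] .
  \<comment> \<open>The new edge at \<open>x\<close> is admissible because \<open>j\<close> itself
    lies between \<open>lo\<close> and \<open>hi\<close>.\<close>
  then have "{j, x} \<in> allowed lo hi (Suc v)" "{v, u} \<in> allowed lo hi (Suc v)"
    using jl u x(3) xu unfolding allowed_edge by auto
  then have "?H \<subseteq> allowed lo hi (Suc v)" using H unfolding switch_def by blast
  moreover have "\<forall>w\<in>nbrs ?H v. \<not> marked w" unfolding nbv using unmarked u(4) by blast
  ultimately show ?thesis using card_nbrs_switch[OF sg sw] nbv by blast
qed

lemma nbrs_insert:
  "u \<noteq> v \<Longrightarrow> nbrs (insert {u, v} E) w =
    (if w = v then insert u (nbrs E v) else if w = u then insert v (nbrs E u) else nbrs E w)"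
  unfolding nbrs_def by (auto simp: doubleton_eq_iff insert_commute)

lemma nbrs_remove:
  "u \<noteq> v \<Longrightarrow> nbrs (E - {{u, v}}) w =
    (if w = v then nbrs E v - {u} else if w = u then nbrs E u - {v} else nbrs E w)"
  unfolding nbrs_def by (auto simp: doubleton_eq_iff insert_commute)

text \<open>
  \<open>F\<close> holds the edges added to \<open>B\<close> so far, \<open>R\<close> the residual degrees, and \<open>P\<close> stands for
  the assumption that \<open>R0\<close> is realizable, in which case \<open>H\<close> realizes the residual degrees.
  Vertices are processed in decreasing order; \<open>v\<close> is the current one and \<open>mark\<close> records its new
  neighbours.
\<close>

definition row_inv :: "nat \<Rightarrow> nat \<Rightarrow> nat \<Rightarrow> nat \<Rightarrow> nat set set \<Rightarrow> (nat \<Rightarrow> nat) \<Rightarrow> bool \<Rightarrow> nat \<Rightarrow>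
    nat set set \<Rightarrow> (nat \<Rightarrow> nat) \<Rightarrow> (nat \<Rightarrow> nat) \<Rightarrow> bool" where
  "row_inv n lo hi v B R0 P q G R mark \<longleftrightarrow>
    (\<exists>F. G = B \<union> F \<and> F \<subseteq> allowed lo hi n \<and> F \<inter> allowed lo hi v = {} \<and>
       (\<forall>u<v. u \<in> nbrs F v \<longrightarrow> mark u \<noteq> 0) \<and> (\<forall>u<n. card (nbrs F u) + R u = R0 u)) \<and>
    (P \<longrightarrow> (\<exists>H\<subseteq>allowed lo hi (Suc v). (\<forall>u<n. card (nbrs H u) = R u) \<and>
       (\<forall>u\<in>nbrs H v. mark u = 0)) \<and> R v \<le> n - q)"

text \<open>The invariant between two rows. Its first half is unconditional and makes a success
  trustworthy; the half under \<open>P\<close> guarantees success.\<close>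

definition pass_inv :: "nat \<Rightarrow> nat \<Rightarrow> nat \<Rightarrow> nat set set \<Rightarrow> (nat \<Rightarrow> nat) \<Rightarrow> bool \<Rightarrow> nat \<Rightarrow>
    nat set set \<Rightarrow> (nat \<Rightarrow> nat) \<Rightarrow> bool" where
  "pass_inv n lo hi B R0 P m G R \<longleftrightarrow>
    (\<exists>F. G = B \<union> F \<and> F \<subseteq> allowed lo hi n \<and> F \<inter> allowed lo hi m = {} \<and>
       (\<forall>u<n. card (nbrs F u) + R u = R0 u)) \<and>
    (P \<longrightarrow> (\<exists>H\<subseteq>allowed lo hi m. \<forall>u<n. card (nbrs H u) = R u))"

lemma row_inv_start:
  assumes "pass_inv n lo hi B R0 P (Suc v) G R" "v < n" "\<And>u. u < n \<Longrightarrow> mark u = 0"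
  shows "row_inv n lo hi v B R0 P 0 G R mark"
  unfolding row_inv_def
proof (intro conjI impI)
  obtain F where F: "G = B \<union> F" "F \<subseteq> allowed lo hi n" "F \<inter> allowed lo hi (Suc v) = {}"
    "\<forall>u<n. card (nbrs F u) + R u = R0 u"
    using assms(1) unfolding pass_inv_def by blast
  have "u \<notin> nbrs F v" if "u < v" for u
  proof
    assume "u \<in> nbrs F v"
    then have "{u, v} \<in> F" by (simp add: nbrs_def)
    then have "{u, v} \<in> allowed lo hi n" "{u, v} \<notin> allowed lo hi (Suc v)" using F by blast+
    then show False using that unfolding allowed_edge by auto
  qed
  moreover have "F \<inter> allowed lo hi v = {}"
    using F(3) allowed_mono[of v "Suc v" lo hi] by auto
  ultimately show "\<exists>F. G = B \<union> F \<and> F \<subseteq> allowed lo hi n \<and> F \<inter> allowed lo hi v = {} \<and>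
       (\<forall>u<v. u \<in> nbrs F v \<longrightarrow> mark u \<noteq> 0) \<and> (\<forall>u<n. card (nbrs F u) + R u = R0 u)"
    using F by blast
next
  assume P
  then obtain H where H: "H \<subseteq> allowed lo hi (Suc v)" "\<forall>u<n. card (nbrs H u) = R u"
    using assms(1) unfolding pass_inv_def by blast
  have sg: "simple_graph n H" using simple_graph_allowed[OF _ H(1)] assms(2) by simp
  have "\<forall>u\<in>nbrs H v. mark u = 0" using assms(3) nbrs_less[OF sg] by simp
  then show "\<exists>H\<subseteq>allowed lo hi (Suc v). (\<forall>u<n. card (nbrs H u) = R u) \<and> (\<forall>u\<in>nbrs H v. mark u = 0)"
    using H by (intro exI[of _ H] conjI)
  have "card (nbrs H v) \<le> card {..<n}" using nbrs_less[OF sg] by (intro card_mono) auto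
  then show "R v \<le> n - 0" using H(2) assms(2) by simp
qed

text \<open>The bound \<open>R v \<le> n - q\<close> becomes \<open>R v = 0\<close> at
  \<open>q = n\<close>. Under \<open>P\<close> the residual graph \<open>H\<close> thus has no edge
  at \<open>v\<close>, so all its larger endpoints are below \<open>v\<close>.\<close>

lemma row_inv_finish:
  assumes "row_inv n lo hi v B R0 P n G R mark" "v < n"
  shows "pass_inv n lo hi B R0 P v G R"
  unfolding pass_inv_def
proof (intro conjI impI)
  show "\<exists>F. G = B \<union> F \<and> F \<subseteq> allowed lo hi n \<and> F \<inter> allowed lo hi v = {} \<and>
       (\<forall>u<n. card (nbrs F u) + R u = R0 u)"
    using assms(1) unfolding row_inv_def by blast
next
  assume P
  then obtain H where H: "H \<subseteq> allowed lo hi (Suc v)" "\<forall>u<n. card (nbrs H u) = R u" and "R v = 0"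
    using assms(1) unfolding row_inv_def by auto
  have sg: "simple_graph n H" using simple_graph_allowed[OF _ H(1)] assms(2) by simp
  have "card (nbrs H v) = 0" using H(2) \<open>R v = 0\<close> assms(2) by simp
  then have empty: "nbrs H v = {}" using finite_nbrs[OF sg] by simp
  have "e \<in> allowed lo hi v" if e: "e \<in> H" for e
  proof -
    obtain u w where uw: "e = {u, w}" "lo \<le> u" "u < hi" "u < w" "w < Suc v"
      using H(1) e by (blast elim: allowed_cases)
    have "w \<noteq> v" using empty e uw(1) by (auto simp: nbrs_def)
    then show ?thesis unfolding uw(1) allowed_edge using uw by auto
  qed
  then show "\<exists>H\<subseteq>allowed lo hi v. \<forall>u<n. card (nbrs H u) = R u" using H(2) by blast
qed

text \<open>The loop always makes \<open>n\<close> rounds, so idle ones must keep the invariant.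
  Under \<open>P\<close> idling means that \<open>v\<close> is finished: a remaining neighbour of
  \<open>v\<close> in \<open>H\<close> would be an unmarked candidate of positive residual
  degree.\<close>

lemma row_inv_idle:
  assumes "row_inv n lo hi v B R0 P q G R mark" "v < n"
    and stuck: "R v = 0 \<or> (\<forall>u. lo \<le> u \<and> u < hi \<and> u < v \<and> mark u = 0 \<longrightarrow> R u = 0)"
  shows "row_inv n lo hi v B R0 P (Suc q) G R mark"
proof -
  have "R v = 0" if P
  proof -
    obtain H where H: "H \<subseteq> allowed lo hi (Suc v)" "\<forall>u<n. card (nbrs H u) = R u"
      "\<forall>u\<in>nbrs H v. mark u = 0"
      using assms(1) \<open>P\<close> unfolding row_inv_def by auto
    have sg: "simple_graph n H" using simple_graph_allowed[OF _ H(1)] assms(2) by simp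
    have "nbrs H v = {}" if "R v \<noteq> 0"
    proof (rule ccontr)
      assume "nbrs H v \<noteq> {}"
      then obtain u where u: "u \<in> nbrs H v" by blast
      have "{u, v} \<in> allowed lo hi (Suc v)" using nbrs_allowed[OF H(1) u] .
      then have "lo \<le> u" "u < hi" "u < v" unfolding allowed_edge by auto
      moreover have "mark u = 0" using H(3) u by blast
      ultimately have "R u = 0" using stuck that by blast
      moreover have "v \<in> nbrs H u" using u nbrs_sym by blast
      then have "card (nbrs H u) \<noteq> 0" using finite_nbrs[OF sg] by auto
      ultimately show False using H(2) \<open>u < v\<close> assms(2) by simp
    qed
    then show ?thesis using H(2) assms(2) by fastforce
  qed
  then show ?thesis using assms(1) unfolding row_inv_def by auto
qed

text \<open>As \<open>u\<close> is unmarked, the edge is new in \<open>F\<close>. Under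
  \<open>P\<close>, \<open>H\<close> is first rearranged to contain the edge, which then moves from
  \<open>H\<close> to \<open>F\<close>.\<close>

lemma row_inv_step:
  assumes inv: "row_inv n lo hi v B R0 P q G R mark" and v: "v < n" "0 < R v"
    and u: "lo \<le> u" "u < hi" "u < v" "mark u = 0" "0 < R u"
    and max: "\<And>w. lo \<le> w \<Longrightarrow> w < hi \<Longrightarrow> w < v \<Longrightarrow> mark w = 0 \<Longrightarrow> R w \<le> R u"
  shows "row_inv n lo hi v B R0 P (Suc q) (insert {u, v} G) (R(u := R u - 1, v := R v - 1)) (mark(u := 1))"
  unfolding row_inv_def
proof (intro conjI impI)
  obtain F where F: "G = B \<union> F" "F \<subseteq> allowed lo hi n" "F \<inter> allowed lo hi v = {}"
      "\<forall>u<v. u \<in> nbrs F v \<longrightarrow> mark u \<noteq> 0" "\<forall>u<n. card (nbrs F u) + R u = R0 u"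
    using inv unfolding row_inv_def by blast
  have sg: "simple_graph n F" using simple_graph_allowed[OF _ F(2)] by simp
  note fin = finite_nbrs[OF sg]
  have new: "u \<notin> nbrs F v" "v \<notin> nbrs F u" using F(4) u nbrs_sym[of v F u] by auto
  have nb: "nbrs (insert {u, v} F) w =
    (if w = v then insert u (nbrs F v) else if w = u then insert v (nbrs F u) else nbrs F w)" for w
    using u by (intro nbrs_insert) simp
  have uv: "{u, v} \<in> allowed lo hi n" "{u, v} \<notin> allowed lo hi v"
    unfolding allowed_edge using u v by auto
  have "card (nbrs (insert {u, v} F) w) + (R(u := R u - 1, v := R v - 1)) w = R0 w" if "w < n" for w
    using F(5) that fin new u v by (fastforce simp: nb)
  moreover have "\<forall>w<v. w \<in> nbrs (insert {u, v} F) v \<longrightarrow> (mark(u := 1)) w \<noteq> 0" using F(4) by (auto simp: nb)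
  moreover have "insert {u, v} G = B \<union> insert {u, v} F" using F(1) by blast
  moreover have "insert {u, v} F \<subseteq> allowed lo hi n" "insert {u, v} F \<inter> allowed lo hi v = {}"
    using F uv by auto
  ultimately show "\<exists>F. insert {u, v} G = B \<union> F \<and> F \<subseteq> allowed lo hi n \<and> F \<inter> allowed lo hi v = {} \<and>
       (\<forall>w<v. w \<in> nbrs F v \<longrightarrow> (mark(u := 1)) w \<noteq> 0) \<and>
       (\<forall>w<n. card (nbrs F w) + (R(u := R u - 1, v := R v - 1)) w = R0 w)"
    by blast
next
  assume P
  then obtain H where H: "H \<subseteq> allowed lo hi (Suc v)" "\<forall>u<n. card (nbrs H u) = R u"
    "\<forall>u\<in>nbrs H v. mark u = 0" and "R v \<le> n - q"
    using inv unfolding row_inv_def by blast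
  then show "(R(u := R u - 1, v := R v - 1)) v \<le> n - Suc q" by simp
  have "nbrs H v \<noteq> {}" using H(2) v by fastforce
  moreover have "card (nbrs H w) \<le> card (nbrs H u)" if "lo \<le> w" "w < hi" "w < v" "mark w = 0" for w
    using max[OF that] H(2) that(3) u(3) v(1) by simp
  ultimately obtain H' where H': "H' \<subseteq> allowed lo hi (Suc v)" "\<forall>w. card (nbrs H' w) = card (nbrs H w)"
    "u \<in> nbrs H' v" "\<forall>w\<in>nbrs H' v. mark w = 0"
    using max_residual_neighbour[of H lo hi v u "\<lambda>u. mark u \<noteq> 0"] H u by auto
  have sg: "simple_graph n H'" using simple_graph_allowed[OF _ H'(1)] v by simp
  have vu: "v \<in> nbrs H' u" using H'(3) nbrs_sym by blast
  have nb: "nbrs (H' - {{u, v}}) w =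
    (if w = v then nbrs H' v - {u} else if w = u then nbrs H' u - {v} else nbrs H' w)" for w
    using u by (intro nbrs_remove) simp
  have "card (nbrs (H' - {{u, v}}) w) = (R(u := R u - 1, v := R v - 1)) w" if "w < n" for w
    using H(2) H'(2,3) vu that finite_nbrs[OF sg] by (simp add: nb card_Diff_singleton)
  moreover have "\<forall>w\<in>nbrs (H' - {{u, v}}) v. (mark(u := 1)) w = 0" using H'(4) by (simp add: nb)
  moreover have "H' - {{u, v}} \<subseteq> allowed lo hi (Suc v)" using H'(1) by blast
  ultimately show "\<exists>H\<subseteq>allowed lo hi (Suc v). (\<forall>w<n. card (nbrs H w) = (R(u := R u - 1, v := R v - 1)) w) \<and>
       (\<forall>w\<in>nbrs H v. (mark(u := 1)) w = 0)"
    by blast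
qed

lemma pass_inv_start:
  assumes "P \<Longrightarrow> \<exists>H\<subseteq>allowed lo hi n. \<forall>u<n. card (nbrs H u) = R u"
  shows "pass_inv n lo hi B R P n B R"
  unfolding pass_inv_def
proof (intro conjI impI)
  have "nbrs {} u = {}" for u by (simp add: nbrs_def)
  then show "\<exists>F. B = B \<union> F \<and> F \<subseteq> allowed lo hi n \<and> F \<inter> allowed lo hi n = {} \<and>
       (\<forall>u<n. card (nbrs F u) + R u = R u)"
    by (intro exI[of _ "{}"]) simp
qed (rule assms)

lemma pass_inv_finish:
  assumes "pass_inv n lo hi B R0 P 0 G R"
  shows "\<exists>F\<subseteq>allowed lo hi n. G = B \<union> F \<and> (\<forall>u<n. card (nbrs F u) + R u = R0 u)"
    "P \<Longrightarrow> u < n \<Longrightarrow> R u = 0"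
proof -
  show "\<exists>F\<subseteq>allowed lo hi n. G = B \<union> F \<and> (\<forall>u<n. card (nbrs F u) + R u = R0 u)"
    using assms unfolding pass_inv_def by blast
  assume P "u < n"
  then obtain H where "H \<subseteq> allowed lo hi 0" "\<forall>u<n. card (nbrs H u) = R u"
    using assms unfolding pass_inv_def by blast
  moreover from this have "H = {}" by (simp add: allowed_def)
  ultimately show "R u = 0" using \<open>u < n\<close> by (auto simp: nbrs_def)
qed

section \<open>Splitting the degrees between core edges and outside edges\<close>

definition residual :: "nat list \<Rightarrow> nat \<Rightarrow> (nat \<Rightarrow> nat) \<Rightarrow> nat \<Rightarrow> nat" where
  "residual d k g u = (if u < k then d ! u else d ! u - g u)"

definition residual' :: "nat \<Rightarrow> (nat \<Rightarrow> nat) \<Rightarrow> nat \<Rightarrow> nat" where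
  "residual' k g u = (if u < k then 0 else g u)"

text \<open>The passes share no edge, since the smaller endpoint lies in the core for one and
  outside for the other. The strict bound \<open>g u < d ! u\<close> leaves every outside vertex a
  positive degree in \<open>F1\<close>, that is, a core neighbour.\<close>

lemma union_of_passes:
  assumes F1: "F1 \<subseteq> allowed 0 k n" "\<forall>u<n. card (nbrs F1 u) = residual d k g u"
    and F2: "F2 \<subseteq> allowed k n n" "\<forall>u<n. card (nbrs F2 u) = residual' k g u"
    and g: "\<And>u. k \<le> u \<Longrightarrow> u < n \<Longrightarrow> g u < d ! u" and n: "n = length d"
  shows "realizes (F1 \<union> F2) d \<and> covered n k (F1 \<union> F2)"
proof
  have sg1: "simple_graph n F1" and sg2: "simple_graph n F2"
    using simple_graph_allowed F1(1) F2(1) by blast+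
  have sg: "simple_graph n (F1 \<union> F2)" using sg1 sg2 by (simp add: simple_graph_def)
  have nb: "nbrs (F1 \<union> F2) u = nbrs F1 u \<union> nbrs F2 u" for u by (auto simp: nbrs_def)
  have disj: "nbrs F1 u \<inter> nbrs F2 u = {}" for u
  proof (rule ccontr)
    assume "nbrs F1 u \<inter> nbrs F2 u \<noteq> {}"
    then obtain x where x: "x \<in> nbrs F1 u" "x \<in> nbrs F2 u" by blast
    then have "{x, u} \<in> allowed 0 k n" "{x, u} \<in> allowed k n n"
      using nbrs_allowed F1(1) F2(1) by blast+
    then show False unfolding allowed_edge by auto
  qed
  have "card (nbrs (F1 \<union> F2) u) = d ! u" if u: "u < n" for u
  proof -
    have "card (nbrs (F1 \<union> F2) u) = card (nbrs F1 u) + card (nbrs F2 u)"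
      unfolding nb using disj finite_nbrs[OF sg1] finite_nbrs[OF sg2] by (intro card_Un_disjoint) auto
    also have "\<dots> = residual d k g u + residual' k g u" using F1(2) F2(2) u by simp
    also have "\<dots> = d ! u" using g[of u] u by (auto simp: residual_def residual'_def)
    finally show ?thesis .
  qed
  then show "realizes (F1 \<union> F2) d" using sg n by (simp add: realizes_nbrs)
  show "covered n k (F1 \<union> F2)"
    unfolding covered_def
  proof (intro allI impI)
    fix v assume v: "k \<le> v \<and> v < n"
    have "card (nbrs F1 v) \<noteq> 0" using F1(2) v g[of v] by (simp add: residual_def)
    then obtain x where x: "x \<in> nbrs F1 v" by fastforce
    then have "{x, v} \<in> allowed 0 k n" using nbrs_allowed F1(1) by blast
    then have "x < k" using v unfolding allowed_edge by auto
    then show "nbrs (F1 \<union> F2) v \<inter> {..<k} \<noteq> {}" using x unfolding nb by blast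
  qed
qed

lemma split_realization:
  assumes E: "realizes E d" and g: "\<And>v. v \<in> {k..<length d} \<Longrightarrow> odeg k E v = g v"
    and k: "k \<le> length d"
  shows "\<exists>H\<subseteq>allowed 0 k (length d). \<forall>u<length d. card (nbrs H u) = residual d k g u"
    "\<exists>H\<subseteq>allowed k (length d) (length d). \<forall>u<length d. card (nbrs H u) = residual' k g u"
proof -
  let ?n = "length d" and ?H1 = "{e \<in> E. e \<inter> {..<k} \<noteq> {}}" and ?H2 = "{e \<in> E. e \<inter> {..<k} = {}}"
  have sg: "simple_graph ?n E" using E by (simp add: realizes_nbrs)
  have edge: "\<exists>a b. e = {a, b} \<and> a \<noteq> b \<and> a < ?n \<and> b < ?n" if "e \<in> E" for e
    using sg that unfolding simple_graph_def by blast
  have "e \<in> allowed 0 k ?n" if e: "e \<in> ?H1" for e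
  proof -
    obtain a b where "e = {a, b}" "a \<noteq> b" "a < ?n" "b < ?n" using edge e by blast
    moreover from this have "min a b < k" using e by (auto simp: min_def)
    ultimately show ?thesis by (auto simp: allowed_edge)
  qed
  then have 1: "?H1 \<subseteq> allowed 0 k ?n" by blast
  have "e \<in> allowed k ?n ?n" if e: "e \<in> ?H2" for e
  proof -
    obtain a b where "e = {a, b}" "a \<noteq> b" "a < ?n" "b < ?n" using edge e by blast
    moreover from this have "k \<le> min a b" using e by (auto simp: min_def)
    ultimately show ?thesis by (auto simp: allowed_edge)
  qed
  then have 2: "?H2 \<subseteq> allowed k ?n ?n" by blast
  have nb1: "nbrs ?H1 u = (if u < k then nbrs E u else nbrs E u \<inter> {..<k})" for u
    by (auto simp: nbrs_def)
  have nb2: "nbrs ?H2 u = (if u < k then {} else nbrs E u \<inter> {k..})" for u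
    by (auto simp: nbrs_def)
  have du: "card (nbrs E u) = d ! u" if "u < ?n" for u using E that by (simp add: realizes_nbrs)
  have "card (nbrs ?H1 u) = residual d k g u" if u: "u < ?n" for u
    using odeg_card_nbrs[OF sg, of u k] g[of u] du[OF u] u by (auto simp: nb1 residual_def)
  then show "\<exists>H\<subseteq>allowed 0 k ?n. \<forall>u<?n. card (nbrs H u) = residual d k g u" using 1 by blast
  have "card (nbrs ?H2 u) = residual' k g u" if u: "u < ?n" for u
    using g[of u] u by (auto simp: nb2 residual'_def odeg_def)
  then show "\<exists>H\<subseteq>allowed k ?n ?n. \<forall>u<?n. card (nbrs H u) = residual' k g u" using 2 by blast
qed

section \<open>Programs with bounded loops\<close>

definition store :: "memory \<Rightarrow> nat \<Rightarrow> nat \<Rightarrow> nat \<Rightarrow> memory" where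
  "store s a i x = s(a := (s a)(i := x))"

lemma store_same: "store s a i x a = (s a)(i := x)"
  by (simp add: store_def)

lemma store_other: "b \<noteq> a \<Longrightarrow> store s a i x b = s b"
  by (simp add: store_def)

lemmas store_apply = store_same store_other

text \<open>\<open>For x p\<close> runs \<open>p\<close> with cell 0 of array \<open>x\<close> counting from 0 up to, but excluding, the input
  length, so that every program of this language takes polynomial time.\<close>

datatype prog =
    Nop
  | Put nat exp exp
  | Then prog prog (infixr ";;" 60)
  | If test prog prog
  | For nat prog

abbreviation Var :: "nat \<Rightarrow> exp" where
  "Var a \<equiv> Cell a (Const 0)"

abbreviation Set :: "nat \<Rightarrow> exp \<Rightarrow> prog" where
  "Set a \<equiv> Put a (Const 0)"

primrec compile :: "prog \<Rightarrow> com" where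
  "compile Nop = Skip"
| "compile (Put a e f) = Assign a e f"
| "compile (p ;; q) = Seq (compile p) (compile q)"
| "compile (If b p q) = Cond b (compile p) (compile q)"
| "compile (For x p) = Seq (Assign x (Const 0) (Const 0))
     (While (Less (Var x) (Var 0)) (Seq (compile p) (Assign x (Const 0) (Plus (Var x) (Const 1)))))"

primrec run :: "prog \<Rightarrow> memory \<Rightarrow> memory" where
  "run Nop s = s"
| "run (Put a e f) s = store s a (eval_exp e s) (eval_exp f s)"
| "run (p ;; q) s = run q (run p s)"
| "run (If b p q) s = (if eval_test b s then run p s else run q s)"
| "run (For x p) s = ((\<lambda>s. store (run p s) x 0 (Suc (run p s x 0))) ^^ s 0 0) (store s x 0 0)"

primrec written :: "prog \<Rightarrow> nat set" where
  "written Nop = {}"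
| "written (Put a e f) = {a}"
| "written (p ;; q) = written p \<union> written q"
| "written (If b p q) = written p \<union> written q"
| "written (For x p) = insert x (written p)"

primrec wf_prog :: "prog \<Rightarrow> bool" where
  "wf_prog Nop \<longleftrightarrow> True"
| "wf_prog (Put a e f) \<longleftrightarrow> True"
| "wf_prog (p ;; q) \<longleftrightarrow> wf_prog p \<and> wf_prog q"
| "wf_prog (If b p q) \<longleftrightarrow> wf_prog p \<and> wf_prog q"
| "wf_prog (For x p) \<longleftrightarrow> wf_prog p \<and> x \<noteq> 0 \<and> x \<notin> written p \<and> 0 \<notin> written p"

text \<open>In a loop, 9 is 3 for the initial assignment plus 6 for the failing last test; 12 is 6
  for a successful test plus 6 for the increment. The variable \<open>[:0, 1:]\<close> stands for
  the input length. For a conditional the bounds of both branches are added, which avoids a maximum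
  of polynomials.\<close>

primrec time_bound :: "prog \<Rightarrow> nat poly" where
  "time_bound Nop = 1"
| "time_bound (Put a e f) = [:1 + cost_exp e + cost_exp f:]"
| "time_bound (p ;; q) = time_bound p + time_bound q"
| "time_bound (If b p q) = [:1 + cost_test b:] + time_bound p + time_bound q"
| "time_bound (For x p) = 9 + [:0, 1:] * (time_bound p + 12)"

lemma run_frame: "a \<notin> written p \<Longrightarrow> run p s a = s a"
proof (induction p arbitrary: s)
  case (For x p)
  have "((\<lambda>s. store (run p s) x 0 (Suc (run p s x 0))) ^^ m) s a = s a" for m s
    by (induction m) (use For in \<open>auto simp: store_apply\<close>)
  then show ?case using For.prems by (simp add: store_apply)
qed (auto simp: store_apply)

text \<open>The body of a well-formed loop writes neither its counter nor array 0, so the number of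
  rounds is fixed on entry and the counter agrees with the round.\<close>

lemma For_rule:
  assumes wf: "wf_prog (For x p)" and n: "s 0 0 = n" and start: "I 0 (store s x 0 0)"
    and step: "\<And>i s. i < n \<Longrightarrow> s 0 0 = n \<Longrightarrow> s x 0 = i \<Longrightarrow> I i s \<Longrightarrow> I (Suc i) (store (run p s) x 0 (Suc i))"
  shows "I n (run (For x p) s)"
proof -
  let ?f = "\<lambda>s. store (run p s) x 0 (Suc (run p s x 0))" and ?s = "store s x 0 0"
  have "I m ((?f ^^ m) ?s) \<and> (?f ^^ m) ?s 0 0 = n \<and> (?f ^^ m) ?s x 0 = m" if "m \<le> n" for m
    using that
  proof (induction m)
    case 0
    have "?s 0 0 = n" "?s x 0 = 0" using n wf by (auto simp: store_apply)
    then show ?case using start by simp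
  next
    case (Suc m)
    let ?t = "(?f ^^ m) ?s"
    have t: "I m ?t" "?t 0 0 = n" "?t x 0 = m" using Suc by auto
    moreover have "run p ?t x = ?t x" "run p ?t 0 = ?t 0" using wf by (auto intro: run_frame)
    ultimately show ?case using step[of m ?t] Suc.prems wf by (simp add: store_apply)
  qed
  then show ?thesis using n by simp
qed

text \<open>\<open>0 \<notin> written p\<close> keeps the input length fixed, so the bounds of
  successive parts are evaluated at the same argument.\<close>

lemma exec_compile:
  "wf_prog p \<Longrightarrow> 0 \<notin> written p \<Longrightarrow> \<exists>t. exec (compile p) s t (run p s) \<and> t \<le> poly (time_bound p) (s 0 0)"
proof (induction p arbitrary: s)
  case Nop
  then show ?case using exec.Skip by auto
next
  case (Put a e f)
  show ?case unfolding run.simps compile.simps store_def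
    by (rule exI, rule conjI, rule exec.Assign) simp
next
  case (Then p q)
  obtain t where t: "exec (compile p) s t (run p s)" "t \<le> poly (time_bound p) (s 0 0)"
    using Then by fastforce
  obtain u where u: "exec (compile q) (run p s) u (run q (run p s))" "u \<le> poly (time_bound q) (run p s 0 0)"
    using Then by fastforce
  have "run p s 0 = s 0" using Then.prems by (intro run_frame) simp
  then show ?case using exec.Seq[OF t(1) u(1)] t(2) u(2) by (auto intro!: exI[of _ "t + u"])
next
  case (If b p q)
  obtain t where t: "exec (compile p) s t (run p s)" "t \<le> poly (time_bound p) (s 0 0)"
    using If by fastforce
  obtain u where u: "exec (compile q) s u (run q s)" "u \<le> poly (time_bound q) (s 0 0)"
    using If by fastforce
  show ?case
  proof (cases "eval_test b s")
    case True
    then show ?thesis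
      using exec.CondTrue[OF True t(1), of "compile q"] t(2) by (auto intro!: exI[of _ "1 + cost_test b + t"])
  next
    case False
    then show ?thesis
      using exec.CondFalse[OF False u(1), of "compile p"] u(2) by (auto intro!: exI[of _ "1 + cost_test b + u"])
  qed
next
  case (For x p)
  let ?f = "\<lambda>s. store (run p s) x 0 (Suc (run p s x 0))"
  let ?n = "s 0 0" and ?c = "poly (time_bound p) (s 0 0)"
  let ?b = "Less (Var x) (Var 0)" and ?i = "Assign x (Const 0) (Plus (Var x) (Const 1))"
  have loop: "\<exists>t. exec (While ?b (Seq (compile p) ?i)) s' t ((?f ^^ m) s') \<and> t \<le> 6 + m * (?c + 12)"
    if "s' x 0 + m = ?n" "s' 0 0 = ?n" for m s'
    using that
  proof (induction m arbitrary: s')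
    case 0
    then show ?case using exec.WhileFalse[of ?b s' "Seq (compile p) ?i"] by auto
  next
    case (Suc m)
    have fr: "run p s' x = s' x" "run p s' 0 = s' 0" using For.prems by (auto intro: run_frame)
    obtain t where t: "exec (compile p) s' t (run p s')" "t \<le> ?c"
      using For Suc.prems by fastforce
    have "exec ?i (run p s') 6 (?f s')"
      using exec.Assign[of x "Const 0" "Plus (Var x) (Const 1)" "run p s'"]
      by (simp add: store_def eval_nat_numeral)
    with t(1) have body: "exec (Seq (compile p) ?i) s' (t + 6) (?f s')" by (rule exec.Seq)
    have "(?f s') x 0 + m = ?n" "(?f s') 0 0 = ?n"
      using Suc.prems fr For.prems by (auto simp: store_apply)
    then obtain u where u: "exec (While ?b (Seq (compile p) ?i)) (?f s') u ((?f ^^ m) (?f s'))"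
        "u \<le> 6 + m * (?c + 12)"
      using Suc.IH by blast
    have "eval_test ?b s'" using Suc.prems by simp
    then have "exec (While ?b (Seq (compile p) ?i)) s' (1 + cost_test ?b + (t + 6) + u) ((?f ^^ m) (?f s'))"
      using body u(1) by (rule exec.WhileTrue)
    moreover have "(?f ^^ m) (?f s') = (?f ^^ Suc m) s'" by (simp add: funpow_Suc_right del: funpow.simps)
    ultimately show ?case using t(2) u(2) by (intro exI[of _ "1 + cost_test ?b + (t + 6) + u"]) simp
  qed
  have init: "exec (Assign x (Const 0) (Const 0)) s 3 (store s x 0 0)"
    using exec.Assign[of x "Const 0" "Const 0" s] by (simp add: store_def numeral_3_eq_3)
  obtain t where "exec (While ?b (Seq (compile p) ?i)) (store s x 0 0) t ((?f ^^ ?n) (store s x 0 0))"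
      "t \<le> 6 + ?n * (?c + 12)"
    using loop[of "store s x 0 0" ?n] For.prems by (auto simp: store_apply)
  then show ?case using exec.Seq[OF init]
    by (intro exI[of _ "3 + t"]) (simp add: algebra_simps)
qed

section \<open>The program\<close>

text \<open>
  Scalars live in cell 0 of their array: 5 success flag, 6 and 17 the core size minus 1 and the
  core size \<open>k\<close>, 7 \<open>M\<close>, 8 \<open>r\<close>, 12 and 13 the best candidate and its residual degree, 14 and 15
  the range of admissible smaller endpoints, 16 flag for the current attempt, 18 the current
  vertex \<open>v\<close>, 23 scratch; 9, 10, 11 and 19 are loop counters. Proper arrays: 20 residual degrees,
  21 marks, 22 outside degrees.
\<close>

definition find_prog :: prog where
  "find_prog = Set 13 (Const 0) ;; For 11
     (If (Conj (Neg (Less (Var 11) (Var 14))) (Conj (Less (Var 11) (Var 15)) (Conj (Less (Var 11) (Var 18))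
        (Conj (Less (Cell 21 (Var 11)) (Const 1)) (Less (Var 13) (Cell 20 (Var 11)))))))
      (Set 13 (Cell 20 (Var 11)) ;; Set 12 (Var 11)) Nop)"

definition record_prog :: prog where
  "record_prog = Put 3 (Var 2) (Var 12) ;; Put 4 (Var 2) (Var 18) ;; Set 2 (Plus (Var 2) (Const 1)) ;;
     Put 21 (Var 12) (Const 1) ;; Put 20 (Var 12) (Minus (Cell 20 (Var 12)) (Const 1)) ;;
     Put 20 (Var 18) (Minus (Cell 20 (Var 18)) (Const 1))"

definition step_prog :: prog where
  "step_prog = If (Less (Const 0) (Cell 20 (Var 18)))
     (find_prog ;; If (Less (Const 0) (Var 13)) record_prog Nop) Nop"

text \<open>Loops count upwards, but rows run from the largest vertex down; round \<open>i\<close>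
  therefore treats vertex \<open>n - 1 - i\<close>.\<close>

definition row_prog :: prog where
  "row_prog = Set 18 (Minus (Minus (Var 0) (Const 1)) (Var 9)) ;;
     For 11 (Put 21 (Var 11) (Const 0)) ;; For 10 step_prog"

definition pass_prog :: prog where
  "pass_prog = For 9 row_prog"

definition check_prog :: prog where
  "check_prog = For 19 (If (Less (Const 0) (Cell 20 (Var 19))) (Set 16 (Const 0)) Nop)"

definition target_prog :: prog where
  "target_prog = Set 23 (Var 7) ;; If (Less (Var 19) (Var 8)) (Set 23 (Plus (Var 23) (Const 1))) Nop ;;
     If (Less (Minus (Cell 1 (Var 19)) (Const 1)) (Var 23)) (Set 23 (Minus (Cell 1 (Var 19)) (Const 1))) Nop ;;
     If (Less (Var 23) (Minus (Cell 1 (Var 19)) (Var 17))) (Set 23 (Minus (Cell 1 (Var 19)) (Var 17))) Nop"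

definition init_prog :: prog where
  "init_prog = For 19 (If (Less (Var 19) (Var 17)) (Put 20 (Var 19) (Cell 1 (Var 19)))
     (target_prog ;; Put 22 (Var 19) (Var 23) ;; Put 20 (Var 19) (Minus (Cell 1 (Var 19)) (Var 23))))"

text \<open>Core entries stay as they are: a successful first pass has reduced them to 0, which is
  what the second pass requires.\<close>

definition reload_prog :: prog where
  "reload_prog = For 19 (If (Less (Var 19) (Var 17)) Nop (Put 20 (Var 19) (Cell 22 (Var 19))))"

definition attempt_prog :: prog where
  "attempt_prog = Set 2 (Const 0) ;; Set 16 (Const 1) ;; init_prog ;;
     Set 14 (Const 0) ;; Set 15 (Var 17) ;; pass_prog ;; check_prog ;; reload_prog ;;
     Set 14 (Var 17) ;; Set 15 (Var 0) ;; pass_prog ;; check_prog ;;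
     If (Less (Const 0) (Var 16)) (Set 5 (Const 1)) Nop"

definition search_prog :: prog where
  "search_prog = For 7 (For 8 (If (Less (Var 5) (Const 1)) attempt_prog Nop))"

text \<open>Round \<open>i\<close> tries core size \<open>i + 1\<close>, since an empty core never
  dominates a nonempty vertex set.\<close>

definition main_prog :: prog where
  "main_prog = For 6 (Set 17 (Plus (Var 6) (Const 1)) ;; search_prog)"

lemmas prog_defs = find_prog_def record_prog_def step_prog_def row_prog_def pass_prog_def
  check_prog_def target_prog_def init_prog_def reload_prog_def attempt_prog_def search_prog_def main_prog_def

lemma wf_main_prog: "wf_prog main_prog" "0 \<notin> written main_prog"
  by (simp_all add: prog_defs)

section \<open>Correctness of the greedy pass\<close>

lemma find_prog_correct:
  fixes s :: memory
  defines "C \<equiv> \<lambda>u. s 14 0 \<le> u \<and> u < s 15 0 \<and> u < s 18 0 \<and> s 21 u = 0"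
    and "s' \<equiv> run find_prog s"
  shows "0 < s' 13 0 \<Longrightarrow> C (s' 12 0) \<and> s 20 (s' 12 0) = s' 13 0"
    "\<And>u. u < s 0 0 \<Longrightarrow> C u \<Longrightarrow> s 20 u \<le> s' 13 0"
proof -
  let ?I = "\<lambda>i t. (\<forall>a\<in>{14, 15, 18, 20, 21}. t a = s a) \<and>
    (0 < t 13 0 \<longrightarrow> C (t 12 0) \<and> s 20 (t 12 0) = t 13 0) \<and> (\<forall>u<i. C u \<longrightarrow> s 20 u \<le> t (13::nat) (0::nat))"
  let ?b = "If (Conj (Neg (Less (Var 11) (Var 14))) (Conj (Less (Var 11) (Var 15)) (Conj (Less (Var 11) (Var 18))
        (Conj (Less (Cell 21 (Var 11)) (Const 1)) (Less (Var 13) (Cell 20 (Var 11)))))))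
      (Set 13 (Cell 20 (Var 11)) ;; Set 12 (Var 11)) Nop"
  \<comment> \<open>Cell 0 of array 13 starts at 0 and is only ever raised, so a final 0 means that
    no candidate has positive residual degree.\<close>
  have "?I (s 0 0) (run (For 11 ?b) (store s 13 0 0))"
    by (rule For_rule[where I = ?I]) (auto simp: store_apply C_def less_Suc_eq)
  moreover have "s' = run (For 11 ?b) (store s 13 0 0)"
    by (simp add: s'_def find_prog_def del: run.simps(5))
  ultimately show "0 < s' 13 0 \<Longrightarrow> C (s' 12 0) \<and> s 20 (s' 12 0) = s' 13 0"
    "\<And>u. u < s 0 0 \<Longrightarrow> C u \<Longrightarrow> s 20 u \<le> s' 13 0"
    by auto
qed

lemma output_graph_cong: "s 2 = t 2 \<Longrightarrow> s 3 = t 3 \<Longrightarrow> s 4 = t 4 \<Longrightarrow> output_graph s = output_graph t"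
  by (simp add: output_graph_def)

lemma output_graph_image: "output_graph s = (\<lambda>k. {s 3 k, s 4 k}) ` {..<s 2 0}"
  unfolding output_graph_def by blast

lemma record_prog_correct:
  fixes s :: memory
  defines "u \<equiv> s 12 0" and "v \<equiv> s 18 0"
  assumes "u \<noteq> v"
  shows "output_graph (run record_prog s) = insert {u, v} (output_graph s)"
    "run record_prog s 20 = (s 20)(u := s 20 u - 1, v := s 20 v - 1)"
    "run record_prog s 21 = (s 21)(u := 1)"
proof -
  let ?t = "run record_prog s" and ?m = "s 2 0"
  have t: "?t 2 0 = Suc ?m" "?t 3 = (s 3)(?m := u)" "?t 4 = (s 4)(?m := v)"
    by (auto simp: record_prog_def store_apply u_def v_def fun_eq_iff)
  have "output_graph ?t = insert {?t 3 ?m, ?t 4 ?m} ((\<lambda>k. {?t 3 k, ?t 4 k}) ` {..<?m})"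
    by (simp only: output_graph_image t(1) lessThan_Suc image_insert)
  also have "(\<lambda>k. {?t 3 k, ?t 4 k}) ` {..<?m} = output_graph s"
    unfolding output_graph_image by (rule image_cong) (simp_all add: t)
  finally show "output_graph ?t = insert {u, v} (output_graph s)" by (simp add: t)
  show "?t 20 = (s 20)(u := s 20 u - 1, v := s 20 v - 1)" "?t 21 = (s 21)(u := 1)"
    using assms(3) by (auto simp: record_prog_def store_apply u_def v_def fun_eq_iff)
qed

lemma step_prog_correct:
  assumes inv: "row_inv n (s 14 0) (s 15 0) v B R0 P q (output_graph s) (s 20) (s 21)"
    and s: "s 0 0 = n" "s 18 0 = v" "v < n"
  shows "row_inv n (s 14 0) (s 15 0) v B R0 P (Suc q) (output_graph (run step_prog s))
    (run step_prog s 20) (run step_prog s 21)"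
proof (cases "0 < s 20 v")
  case False
  then show ?thesis using row_inv_idle[OF inv] s by (simp add: step_prog_def)
next
  case True
  let ?t = "run find_prog s"
  note find = find_prog_correct[where s = s]
  have frame: "?t a = s a" if "a \<notin> {11, 12, 13}" for a
    using that by (intro run_frame) (auto simp: find_prog_def)
  have G: "output_graph ?t = output_graph s" by (intro output_graph_cong frame) auto
  show ?thesis
  proof (cases "0 < ?t 13 0")
    case False
    then have "\<forall>u. s 14 0 \<le> u \<and> u < s 15 0 \<and> u < v \<and> s 21 u = 0 \<longrightarrow> s 20 u = 0"
      using find(2) s by fastforce
    moreover have "run step_prog s = ?t" using True False s by (simp add: step_prog_def)
    ultimately show ?thesis using row_inv_idle[OF inv s(3)] G frame by simp
  next
    case pos: True
    let ?u = "?t 12 0"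
    have u: "s 14 0 \<le> ?u" "?u < s 15 0" "?u < v" "s 21 ?u = 0" "0 < s 20 ?u"
      using find(1) pos s by auto
    have max: "s 20 w \<le> s 20 ?u" if "s 14 0 \<le> w" "w < s 15 0" "w < v" "s 21 w = 0" for w
      using find(2)[of w] find(1)[OF pos] that s by auto
    have run_eq: "run step_prog s = run record_prog ?t" using True pos s by (simp add: step_prog_def)
    have tv: "?t 18 0 = v" "?u \<noteq> ?t 18 0" using frame s u by auto
    have eqs: "output_graph (run step_prog s) = insert {?u, v} (output_graph s)"
      "run step_prog s 20 = (s 20)(?u := s 20 ?u - 1, v := s 20 v - 1)"
      "run step_prog s 21 = (s 21)(?u := 1)"
      using record_prog_correct[where s = ?t, OF tv(2)] frame unfolding run_eq tv(1) G by simp_all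
    show ?thesis
      unfolding eqs by (rule row_inv_step[OF inv s(3) True u max])
  qed
qed

lemma row_prog_correct:
  assumes inv: "pass_inv n (s 14 0) (s 15 0) B R0 P (n - i) (output_graph s) (s 20)"
    and s: "s 0 0 = n" "s 9 0 = i" "i < n"
  shows "pass_inv n (s 14 0) (s 15 0) B R0 P (n - Suc i) (output_graph (run row_prog s)) (run row_prog s 20)"
proof -
  define v where "v = n - 1 - i"
  define s1 where "s1 = store s 18 0 v"
  define s2 where "s2 = run (For 11 (Put 21 (Var 11) (Const 0))) s1"
  have v: "v < n" "n - i = Suc v" "n - Suc i = v" using s(3) by (auto simp: v_def)
  have frame: "s2 a = s1 a" if "a \<notin> {11, 21}" for a
    unfolding s2_def by (rule run_frame) (use that in simp)
  have "\<forall>u<n. s2 21 u = 0"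
    unfolding s2_def
    by (rule For_rule[where I = "\<lambda>i t. \<forall>u<i. t 21 u = 0"]) (auto simp: store_apply less_Suc_eq s s1_def)
  moreover have "output_graph s2 = output_graph s"
    by (intro output_graph_cong) (simp_all add: frame s1_def store_apply)
  moreover have s2_eq: "s2 20 = s 20" "s2 14 = s 14" "s2 15 = s 15" "s2 0 = s 0" "s2 18 0 = v"
    by (simp_all add: frame s1_def store_apply)
  ultimately have start: "row_inv n (s 14 0) (s 15 0) v B R0 P 0 (output_graph s2) (s2 20) (s2 21)"
    using row_inv_start[OF inv[unfolded v(2)] v(1)] by simp
  let ?I = "\<lambda>q t. t 14 = s 14 \<and> t 15 = s 15 \<and> t 18 0 = v \<and>
    row_inv n (s 14 0) (s 15 0) v B R0 P q (output_graph t) (t 20) (t 21)"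
  have "?I n (run (For 10 step_prog) s2)"
  proof (rule For_rule[where I = ?I])
    show "wf_prog (For 10 step_prog)" by (simp add: prog_defs)
    show "s2 0 0 = n" using s2_eq s by simp
    have "output_graph (store s2 10 0 0) = output_graph s2"
      by (intro output_graph_cong) (simp_all add: store_apply)
    then show "?I 0 (store s2 10 0 0)" using start s2_eq by (simp add: store_apply)
  next
    fix q t assume t: "q < n" "t 0 0 = n" "t 10 0 = q" "?I q t"
    let ?t = "run step_prog t"
    have "?t a = t a" if "a \<in> {14, 15, 18}" for a
      using that by (intro run_frame) (auto simp: prog_defs)
    moreover have "output_graph (store ?t 10 0 (Suc q)) = output_graph ?t"
      by (intro output_graph_cong) (simp_all add: store_apply)
    moreover have "row_inv n (t 14 0) (t 15 0) v B R0 P (Suc q) (output_graph ?t) (?t 20) (?t 21)"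
      using t v by (intro step_prog_correct) auto
    ultimately show "?I (Suc q) (store ?t 10 0 (Suc q))" using t by (simp add: store_apply)
  qed
  moreover have "run row_prog s = run (For 10 step_prog) s2"
    using s by (simp add: row_prog_def s2_def s1_def v_def del: run.simps(5))
  ultimately show ?thesis using row_inv_finish v by auto
qed

lemma pass_prog_correct:
  assumes s: "s 0 0 = n"
    and P: "P \<Longrightarrow> \<exists>H\<subseteq>allowed (s 14 0) (s 15 0) n. \<forall>u<n. card (nbrs H u) = s 20 u"
  shows "pass_inv n (s 14 0) (s 15 0) (output_graph s) (s 20) P 0 (output_graph (run pass_prog s)) (run pass_prog s 20)"
proof -
  let ?I = "\<lambda>i t. t 14 = s 14 \<and> t 15 = s 15 \<and>
    pass_inv n (s 14 0) (s 15 0) (output_graph s) (s 20) P (n - i) (output_graph t) (t 20)"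
  have "?I n (run (For 9 row_prog) s)"
  proof (rule For_rule[where I = ?I])
    show "s 0 0 = n" by (rule s)
  next
    show "wf_prog (For 9 row_prog)" by (simp add: prog_defs)
    have "output_graph (store s 9 0 0) = output_graph s"
      by (intro output_graph_cong) (simp_all add: store_apply)
    then show "?I 0 (store s 9 0 0)" using pass_inv_start[OF P] by (simp add: store_apply)
  next
    fix i t assume t: "i < n" "t 0 0 = n" "t 9 0 = i" "?I i t"
    let ?t = "run row_prog t"
    have "?t a = t a" if "a \<in> {14, 15}" for a
      using that by (intro run_frame) (auto simp: prog_defs)
    moreover have "output_graph (store ?t 9 0 (Suc i)) = output_graph ?t"
      by (intro output_graph_cong) (simp_all add: store_apply)
    moreover have "pass_inv n (t 14 0) (t 15 0) (output_graph s) (s 20) P (n - Suc i) (output_graph ?t) (?t 20)"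
      using t by (intro row_prog_correct) auto
    ultimately show "?I (Suc i) (store ?t 9 0 (Suc i))" using t by (simp add: store_apply)
  qed
  then show ?thesis by (simp add: pass_prog_def)
qed

section \<open>Correctness of one attempt\<close>

lemma check_prog_correct:
  assumes "s 0 0 = n"
  shows "run check_prog s 16 0 = (if \<forall>u<n. s 20 u = 0 then s 16 0 else 0)"
proof -
  let ?I = "\<lambda>i t. t 20 = s 20 \<and> t 16 0 = (if \<forall>u<i. s 20 u = 0 then s 16 0 else 0)"
  have "?I n (run check_prog s)"
    unfolding check_prog_def by (rule For_rule[where I = ?I]) (use assms in \<open>auto simp: store_apply less_Suc_eq\<close>)
  then show ?thesis by simp
qed

lemma target_prog_correct:
  "run target_prog s 23 0 = max (s 1 (s 19 0) - s 17 0)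
     (min (s 1 (s 19 0) - 1) (s 7 0 + (if s 19 0 < s 8 0 then 1 else 0)))"
  by (auto simp: target_prog_def store_apply max_def min_def)

lemma init_prog_correct:
  assumes s: "s 0 0 = length d" "\<forall>u<length d. s 1 u = d ! u" "s 17 0 = k" "s 7 0 = M" "s 8 0 = r"
  shows "\<forall>u<length d. run init_prog s 20 u = residual d k (target d k M r) u"
    "\<forall>u<length d. k \<le> u \<longrightarrow> run init_prog s 22 u = target d k M r u"
proof -
  let ?I = "\<lambda>i t. (\<forall>a\<in>{1, 7, 8, 17}. t a = s a) \<and>
    (\<forall>u<i. t 20 u = residual d k (target d k M r) u \<and> (k \<le> u \<longrightarrow> t (22::nat) u = target d k M r u))"
  have "?I (length d) (run init_prog s)"
    unfolding init_prog_def
  proof (rule For_rule[where I = ?I])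
    fix i t assume t: "i < length d" "t 0 0 = length d" "t 19 0 = i" "?I i t"
    let ?b = "If (Less (Var 19) (Var 17)) (Put 20 (Var 19) (Cell 1 (Var 19)))
     (target_prog ;; Put 22 (Var 19) (Var 23) ;; Put 20 (Var 19) (Minus (Cell 1 (Var 19)) (Var 23)))"
    let ?t = "store (run ?b t) 19 0 (Suc i)"
    show "?I (Suc i) ?t"
    proof (cases "i < k")
      case True
      then show ?thesis using t s by (simp add: store_apply less_Suc_eq residual_def)
    next
      case False
      let ?g = "run target_prog t"
      have g: "?g 23 0 = target d k M r i" using t s by (simp add: target_prog_correct target_def)
      have fr: "?g a = t a" if "a \<noteq> 23" for a
        using that by (intro run_frame) (simp add: target_prog_def)
      have "?t 20 = (t 20)(i := d ! i - target d k M r i)" "?t 22 = (t 22)(i := target d k M r i)"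
        "\<forall>a\<in>{1, 7, 8, 17}. ?t a = s a"
        using False t s g fr by (auto simp: store_apply fun_eq_iff)
      then show ?thesis using False t(4) by (simp add: less_Suc_eq residual_def)
    qed
  qed (use s in \<open>simp_all add: prog_defs store_apply\<close>)
  then show "\<forall>u<length d. run init_prog s 20 u = residual d k (target d k M r) u"
    "\<forall>u<length d. k \<le> u \<longrightarrow> run init_prog s 22 u = target d k M r u"
    by auto
qed

lemma reload_prog_correct:
  assumes s: "s 0 0 = n" "s 17 0 = k"
  shows "\<forall>u<n. run reload_prog s 20 u = (if u < k then s 20 u else s 22 u)"
proof -
  let ?I = "\<lambda>i t. (\<forall>a\<in>{17, 22}. t a = s a) \<and> (\<forall>u\<ge>i. t 20 u = s 20 u) \<and>
    (\<forall>u<i. t (20::nat) u = (if u < k then s 20 u else s 22 u))"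
  have "?I n (run reload_prog s)"
    unfolding reload_prog_def
    by (rule For_rule[where I = ?I]) (auto simp: store_apply less_Suc_eq s)
  then show ?thesis by auto
qed

text \<open>Soundness rests on the unconditional halves of the two pass invariants together with
  zero residuals. Completeness rests on the other halves, with \<open>P\<close> saying that some
  realization has the target as its outside degrees.\<close>

lemma attempt_prog_correct:
  assumes s: "s 0 0 = length d" "\<forall>u<length d. s 1 u = d ! u" "s 17 0 = k" "s 7 0 = M" "s 8 0 = r"
    and k: "1 \<le> k" "k \<le> length d" and deg: "degree_sequence d" and fresh: "s 5 0 = 0"
  defines "s' \<equiv> run attempt_prog s"
  shows "s' 5 0 \<noteq> 0 \<Longrightarrow> realizes (output_graph s') d \<and> covered (length d) k (output_graph s')"
    "\<exists>E. realizes E d \<and> (\<forall>v\<in>{k..<length d}. odeg k E v = target d k M r v) \<Longrightarrow> s' 5 0 \<noteq> 0"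
proof -
  define n where "n = length d"
  define g where "g = target d k M r"
  define P where "P \<longleftrightarrow> (\<exists>E. realizes E d \<and> (\<forall>v\<in>{k..<n}. odeg k E v = g v))"
  define s0 where "s0 = store (store s 2 0 0) 16 0 1"
  define s1 where "s1 = run init_prog s0"
  define s2 where "s2 = store (store s1 14 0 0) 15 0 k"
  define s3 where "s3 = run pass_prog s2"
  define s4 where "s4 = run check_prog s3"
  define s5 where "s5 = run reload_prog s4"
  define s6 where "s6 = store (store s5 14 0 k) 15 0 n"
  define s7 where "s7 = run pass_prog s6"
  define s8 where "s8 = run check_prog s7"
  have f1: "s1 a = s0 a" if "a \<notin> {19, 20, 22, 23}" for a
    unfolding s1_def by (rule run_frame) (use that in \<open>simp add: init_prog_def target_prog_def\<close>)
  have f3: "s3 a = s2 a" if "a \<notin> {2, 3, 4, 9, 10, 11, 12, 13, 18, 20, 21}" for a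
    unfolding s3_def by (rule run_frame) (use that in \<open>simp add: prog_defs\<close>)
  have f4: "s4 a = s3 a" if "a \<notin> {16, 19}" for a
    unfolding s4_def by (rule run_frame) (use that in \<open>simp add: check_prog_def\<close>)
  have f5: "s5 a = s4 a" if "a \<notin> {19, 20}" for a
    unfolding s5_def by (rule run_frame) (use that in \<open>simp add: reload_prog_def\<close>)
  have f7: "s7 a = s6 a" if "a \<notin> {2, 3, 4, 9, 10, 11, 12, 13, 18, 20, 21}" for a
    unfolding s7_def by (rule run_frame) (use that in \<open>simp add: prog_defs\<close>)
  have f8: "s8 a = s7 a" if "a \<notin> {16, 19}" for a
    unfolding s8_def by (rule run_frame) (use that in \<open>simp add: check_prog_def\<close>)
  have s0: "s0 0 0 = length d" "\<forall>u<length d. s0 1 u = d ! u" "s0 17 0 = k" "s0 7 0 = M" "s0 8 0 = r"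
    using s by (simp_all add: s0_def store_apply)
  have n_eq: "s0 0 0 = n" "s1 0 0 = n" "s2 0 0 = n" "s3 0 0 = n" "s4 0 0 = n" "s5 0 0 = n" "s6 0 0 = n" "s7 0 0 = n" "s8 0 0 = n"
    using s by (simp_all add: f1 f3 f4 f5 f7 f8 s0_def s2_def s6_def store_apply n_def)
  have k_eq: "s1 17 0 = k" "s4 17 0 = k" "s5 17 0 = k"
    using s by (simp_all add: f1 f3 f4 f5 s0_def s2_def store_apply)
  have flags: "s3 16 0 = 1" "s7 16 0 = s4 16 0" "s8 5 0 = 0"
    using fresh by (simp_all add: f1 f3 f4 f5 f7 f8 s0_def s2_def s6_def store_apply)
  have lohi: "s2 14 0 = 0" "s2 15 0 = k" "s6 14 0 = k" "s6 15 0 = n"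
    by (simp_all add: s2_def s6_def store_apply)
  have R2: "\<forall>u<n. s2 20 u = residual d k g u" and g22: "\<forall>u<n. k \<le> u \<longrightarrow> s1 22 u = g u"
    using init_prog_correct[OF s0] by (auto simp: s1_def s2_def store_apply n_def g_def)
  have G2: "output_graph s2 = {}"
    by (simp add: output_graph_def f1 s0_def s2_def store_apply)
  have P1: "\<exists>H\<subseteq>allowed (s2 14 0) (s2 15 0) n. \<forall>u<n. card (nbrs H u) = s2 20 u" if P
    using that split_realization(1)[of _ d k g] k R2 unfolding P_def lohi n_def by metis
  have pass1: "pass_inv n 0 k {} (s2 20) P 0 (output_graph s3) (s3 20)"
    using pass_prog_correct[of s2 n P, folded s3_def] n_eq(3) P1 unfolding lohi G2 by blast
  obtain F1 where F1: "F1 \<subseteq> allowed 0 k n" "output_graph s3 = F1" "\<forall>u<n. card (nbrs F1 u) + s3 20 u = s2 20 u"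
    using pass_inv_finish(1)[OF pass1] by auto
  have zero1: "s3 20 u = 0" if P "u < n" for u
    using pass_inv_finish(2)[OF pass1 that] .
  have ok1: "s4 16 0 = (if \<forall>u<n. s3 20 u = 0 then 1 else 0)"
    using check_prog_correct[of s3 n] n_eq(4) by (simp add: s4_def flags)
  have R6: "\<forall>u<n. s6 20 u = (if u < k then s3 20 u else g u)"
    using reload_prog_correct[of s4 n k] n_eq(5) k_eq(2) g22
    by (simp add: s6_def store_apply s5_def[symmetric] f4 f3 s2_def)
  have G6: "output_graph s6 = F1"
    unfolding F1(2)[symmetric] by (intro output_graph_cong) (simp_all add: s6_def store_apply f5 f4)
  have P2: "\<exists>H\<subseteq>allowed (s6 14 0) (s6 15 0) n. \<forall>u<n. card (nbrs H u) = s6 20 u" if P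
  proof -
    obtain E where E: "realizes E d" "\<And>v. v \<in> {k..<length d} \<Longrightarrow> odeg k E v = g v"
      using \<open>P\<close> unfolding P_def n_def by blast
    obtain H where H: "H \<subseteq> allowed k n n" "\<forall>u<n. card (nbrs H u) = residual' k g u"
      using split_realization(2)[OF E k(2)] unfolding n_def by blast
    \<comment> \<open>Under \<open>P\<close> the first pass has used up all core degrees, so the
      core entries that survive the reload are 0.\<close>
    have "residual' k g u = s6 20 u" if "u < n" for u
      using R6 zero1[OF \<open>P\<close>] that by (simp add: residual'_def)
    then have "\<forall>u<n. card (nbrs H u) = s6 20 u" using H(2) by simp
    then show ?thesis unfolding lohi using H(1) by blast
  qed
  have pass2: "pass_inv n k n F1 (s6 20) P 0 (output_graph s7) (s7 20)"
    using pass_prog_correct[of s6 n P, folded s7_def] n_eq(7) P2 unfolding lohi G6 by blast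
  obtain F2 where F2: "F2 \<subseteq> allowed k n n" "output_graph s7 = F1 \<union> F2" "\<forall>u<n. card (nbrs F2 u) + s7 20 u = s6 20 u"
    using pass_inv_finish(1)[OF pass2] by auto
  have zero2: "s7 20 u = 0" if P "u < n" for u
    using pass_inv_finish(2)[OF pass2 that] .
  have ok2: "s8 16 0 = (if \<forall>u<n. s7 20 u = 0 then s4 16 0 else 0)"
    unfolding s8_def using check_prog_correct[of s7 n] n_eq(8) flags(2) by metis
  have s'_eq: "s' = (if 0 < s8 16 0 then store s8 5 0 1 else s8)"
  proof -
    have "run (Set 16 (Const 1)) (run (Set 2 (Const 0)) s) = s0" by (simp add: s0_def)
    moreover have "run (Set 15 (Var 17)) (run (Set 14 (Const 0)) s1) = s2"
      using k_eq by (simp add: s2_def store_apply)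
    moreover have "run (Set 15 (Var 0)) (run (Set 14 (Var 17)) s5) = s6"
      using k_eq n_eq by (simp add: s6_def store_apply)
    ultimately have "s' = run (If (Less (Const 0) (Var 16)) (Set 5 (Const 1)) Nop) s8"
      by (simp only: s'_def attempt_prog_def run.simps(3) s1_def s3_def s4_def s5_def s7_def s8_def)
    then show ?thesis by simp
  qed
  have success: "s' 5 0 \<noteq> 0 \<longleftrightarrow> 0 < s8 16 0"
    using flags unfolding s'_eq by (simp add: store_apply)
  show "s' 5 0 \<noteq> 0" if "\<exists>E. realizes E d \<and> (\<forall>v\<in>{k..<length d}. odeg k E v = target d k M r v)"
  proof -
    have P using that by (simp add: P_def n_def g_def)
    then show ?thesis unfolding success ok2 ok1 using zero1 zero2 by simp
  qed
  show "realizes (output_graph s') d \<and> covered (length d) k (output_graph s')" if "s' 5 0 \<noteq> 0"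
  proof -
    have z: "\<forall>u<n. s7 20 u = 0" "\<forall>u<n. s3 20 u = 0"
      using that unfolding success ok2 ok1 by (auto split: if_splits)
    have "output_graph s' = output_graph s7"
      unfolding s'_eq by (intro output_graph_cong) (auto simp: store_apply f8)
    \<comment> \<open>Both arguments of \<open>max\<close> in the target are below
      \<open>d ! u\<close>, because \<open>d ! u\<close> is positive and
      \<open>1 \<le> k\<close>.\<close>
    moreover have "g u < d ! u" if "k \<le> u" "u < n" for u
      using degree_sequence_pos[OF deg, of u] that k by (auto simp: g_def target_def n_def)
    then have "realizes (F1 \<union> F2) d \<and> covered n k (F1 \<union> F2)"
      using F1 F2 z R2 R6 by (intro union_of_passes[of _ k n d g]) (auto simp: residual'_def n_def)
    ultimately show ?thesis using F2(2) n_def by simp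
  qed
qed

section \<open>The search over core sizes and levels\<close>

definition found_within :: "nat list \<Rightarrow> nat \<Rightarrow> memory \<Rightarrow> bool" where
  "found_within d K s \<longleftrightarrow> (\<forall>u<length d. s 1 u = d ! u) \<and>
    (s 5 0 \<noteq> 0 \<longrightarrow> realizes (output_graph s) d \<and> (\<exists>k\<le>K. k \<le> length d \<and> covered (length d) k (output_graph s)))"

lemma found_within_store:
  "found_within d K (store s a i x) \<longleftrightarrow> found_within d K s" if "a \<notin> {1, 2, 3, 4, 5}"
proof -
  have "output_graph (store s a i x) = output_graph s"
    using that by (intro output_graph_cong) (auto simp: store_apply)
  moreover have "store s a i x 1 = s 1" "store s a i x 5 = s 5" using that by (auto simp: store_apply)
  ultimately show ?thesis by (simp add: found_within_def)
qed

text \<open>\<open>K\<close> will be the optimum. An attempt at size \<open>k\<close> is executed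
  only while the flag is 0, which by hypothesis forces \<open>k \<le> K\<close>. So a recorded graph
  is always dominated by a core of size at most \<open>K\<close>, and later rounds cannot overwrite
  it.\<close>

lemma guarded_attempt_correct:
  assumes s: "s 0 0 = length d" "s 17 0 = k" "s 7 0 = M" "s 8 0 = r"
    and k: "1 \<le> k" "k \<le> length d" and deg: "degree_sequence d"
    and inv: "found_within d K s" "K < k \<longrightarrow> s 5 0 \<noteq> 0"
  defines "s' \<equiv> run (If (Less (Var 5) (Const 1)) attempt_prog Nop) s"
  shows "found_within d K s'" "s 5 0 \<noteq> 0 \<Longrightarrow> s' 5 0 \<noteq> 0"
    "\<exists>E. realizes E d \<and> (\<forall>v\<in>{k..<length d}. odeg k E v = target d k M r v) \<Longrightarrow> s' 5 0 \<noteq> 0"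
    "s' 17 = s 17" "s' 7 = s 7"
proof -
  have s1: "\<forall>u<length d. s 1 u = d ! u" using inv(1) by (simp add: found_within_def)
  have frame: "run attempt_prog s a = s a" if "a \<in> {1, 7, 17}" for a
    using that by (intro run_frame) (auto simp: prog_defs)
  show "s' 17 = s 17" "s' 7 = s 7" using frame by (auto simp: s'_def)
  show "s 5 0 \<noteq> 0 \<Longrightarrow> s' 5 0 \<noteq> 0" by (simp add: s'_def)
  show "found_within d K s'"
  proof (cases "s 5 0 = 0")
    case True
    then have "k \<le> K" "s' = run attempt_prog s" using inv(2) by (auto simp: s'_def)
    then show ?thesis
      using attempt_prog_correct(1)[OF s(1) s1 s(2-4) k deg True] frame s1 k
      unfolding found_within_def by auto
  next
    case False
    then show ?thesis using inv(1) by (simp add: s'_def)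
  qed
  show "s' 5 0 \<noteq> 0" if "\<exists>E. realizes E d \<and> (\<forall>v\<in>{k..<length d}. odeg k E v = target d k M r v)"
    using attempt_prog_correct(2)[OF s(1) s1 s(2-4) k deg _ that] by (cases "s 5 0 = 0") (auto simp: s'_def)
qed

lemma search_prog_correct:
  assumes s: "s 0 0 = length d" "s 17 0 = k"
    and k: "1 \<le> k" "k \<le> length d" and deg: "degree_sequence d"
    and inv: "found_within d K s" "K < k \<longrightarrow> s 5 0 \<noteq> 0"
  defines "s' \<equiv> run search_prog s"
  shows "found_within d K s'" "s 5 0 \<noteq> 0 \<Longrightarrow> s' 5 0 \<noteq> 0"
    "\<exists>M<length d. \<exists>r<length d. \<exists>E. realizes E d \<and> (\<forall>v\<in>{k..<length d}. odeg k E v = target d k M r v)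
      \<Longrightarrow> s' 5 0 \<noteq> 0"
proof -
  let ?n = "length d" and ?body = "If (Less (Var 5) (Const 1)) attempt_prog Nop"
  let ?F = "\<lambda>M r. \<exists>E. realizes E d \<and> (\<forall>v\<in>{k..<length d}. odeg k E v = target d k M r v)"
  let ?I = "\<lambda>M t. t 17 0 = k \<and> found_within d K t \<and> (s 5 0 \<noteq> 0 \<longrightarrow> t 5 0 \<noteq> 0) \<and>
    (\<forall>M'<M. \<forall>r<?n. ?F M' r \<longrightarrow> t (5::nat) (0::nat) \<noteq> (0::nat))"
  have "?I ?n (run search_prog s)"
    unfolding search_prog_def
  proof (rule For_rule[where I = ?I])
    show "wf_prog (For 7 (For 8 ?body))" by (simp add: prog_defs)
    show "s 0 0 = ?n" by (rule s)
    show "?I 0 (store s 7 0 0)" using s inv by (simp add: store_apply found_within_store)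
  next
    fix M t assume t: "M < ?n" "t 0 0 = ?n" "t 7 0 = M" "?I M t"
    let ?J = "\<lambda>r u. u 7 0 = M \<and> u 17 0 = k \<and> found_within d K u \<and> (s 5 0 \<noteq> 0 \<longrightarrow> u 5 0 \<noteq> 0) \<and>
      (\<forall>M'<M. \<forall>r<?n. ?F M' r \<longrightarrow> u 5 0 \<noteq> 0) \<and> (\<forall>r'<r. ?F M r' \<longrightarrow> u (5::nat) (0::nat) \<noteq> (0::nat))"
    have "?J ?n (run (For 8 ?body) t)"
    proof (rule For_rule[where I = ?J])
      show "wf_prog (For 8 ?body)" by (simp add: prog_defs)
      show "t 0 0 = ?n" by (rule t)
      show "?J 0 (store t 8 0 0)" using t by (simp add: store_apply found_within_store)
    next
      fix r u assume u: "r < ?n" "u 0 0 = ?n" "u 8 0 = r" "?J r u"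
      have J: "u 7 0 = M" "u 17 0 = k" "found_within d K u" "K < k \<longrightarrow> u 5 0 \<noteq> 0"
        using u(4) inv(2) by blast+
      note ga = guarded_attempt_correct[OF u(2) J(2) J(1) u(3) k deg J(3,4)]
      let ?u = "run ?body u"
      have "store ?u 8 0 (Suc r) 5 = ?u 5" "store ?u 8 0 (Suc r) 7 = u 7" "store ?u 8 0 (Suc r) 17 = u 17"
        using ga(4,5) by (simp_all add: store_apply del: run.simps)
      moreover have "found_within d K (store ?u 8 0 (Suc r))"
        by (rule found_within_store[THEN iffD2, OF _ ga(1)]) simp
      moreover have "\<forall>r'<Suc r. ?F M r' \<longrightarrow> ?u 5 0 \<noteq> 0"
        using ga(2,3) u(4) unfolding less_Suc_eq by blast
      moreover have "\<forall>M'<M. \<forall>r<?n. ?F M' r \<longrightarrow> ?u 5 0 \<noteq> 0" "s 5 0 \<noteq> 0 \<longrightarrow> ?u 5 0 \<noteq> 0"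
        using ga(2) u(4) by blast+
      ultimately show "?J (Suc r) (store ?u 8 0 (Suc r))" using J(1,2) by (simp only:)
    qed
    then have J: "run (For 8 ?body) t 17 0 = k" "found_within d K (run (For 8 ?body) t)"
      "s 5 0 \<noteq> 0 \<longrightarrow> run (For 8 ?body) t 5 0 \<noteq> 0"
      "\<forall>M'<Suc M. \<forall>r<?n. ?F M' r \<longrightarrow> run (For 8 ?body) t 5 0 \<noteq> 0"
      unfolding less_Suc_eq by blast+
    let ?t = "store (run (For 8 ?body) t) 7 0 (Suc M)"
    have "?t 17 = run (For 8 ?body) t 17" "?t 5 = run (For 8 ?body) t 5"
      by (rule store_other; simp)+
    moreover have "found_within d K ?t"
      by (rule found_within_store[THEN iffD2, OF _ J(2)]) simp
    ultimately show "?I (Suc M) ?t" using J by (simp only:)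
  qed
  then show "found_within d K s'" "s 5 0 \<noteq> 0 \<Longrightarrow> s' 5 0 \<noteq> 0"
    "\<exists>M<length d. \<exists>r<length d. ?F M r \<Longrightarrow> s' 5 0 \<noteq> 0"
    unfolding s'_def by blast+
qed

section \<open>Optimality of the output\<close>

lemma covered_MDS_seq:
  assumes "graphic d"
  shows "\<exists>E. realizes E d \<and> covered (length d) (MDS_seq d) E" "MDS_seq d \<le> length d"
proof -
  have deg: "degree_sequence d" and "\<exists>E. realizes E d" using assms by (auto simp: graphic_def)
  then obtain E where E: "realizes E d" "MDS_graph (length d) E = MDS_seq d"
    using MDS_seq_attained by blast
  obtain D where D: "dominating_set (length d) E D" "card D = MDS_seq d"
    using MDS_graph_attained E(2) by metis
  show "\<exists>E. realizes E d \<and> covered (length d) (MDS_seq d) E"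
    using covered_of_dominating_set[OF deg E(1) D(1)] D(2) by simp
  have "D \<subseteq> {..<length d}" using D(1) by (simp add: dominating_set_def)
  then have "card D \<le> card {..<length d}" by (intro card_mono) simp
  then show "MDS_seq d \<le> length d" using D(2) by simp
qed

lemma MDS_seq_pos:
  assumes "graphic d" "0 < length d"
  shows "1 \<le> MDS_seq d"
proof (rule ccontr)
  assume "\<not> 1 \<le> MDS_seq d"
  then have "\<exists>E. covered (length d) 0 E" using covered_MDS_seq(1)[OF assms(1)] by (auto simp: not_le)
  then show False using assms(2) by (auto simp: covered_def)
qed

text \<open>The flag is set after round \<open>k = MDS_seq d\<close> at the latest, as a levelled
  realization exists for this \<open>k\<close>. The recorded graph has a dominating core of at most
  that size, and no realization can do better than \<open>MDS_seq d\<close>.\<close>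

lemma main_prog_correct:
  assumes gr: "graphic d" and n: "0 < length d"
  defines "s' \<equiv> run main_prog (input_memory d)"
  shows "realizes (output_graph s') d \<and> MDS_graph (length d) (output_graph s') = MDS_seq d"
proof -
  let ?n = "length d" and ?K = "MDS_seq d"
  let ?s = "input_memory d"
  have deg: "degree_sequence d" using gr by (simp add: graphic_def)
  let ?I = "\<lambda>i t. found_within d ?K t \<and> (?K \<le> i \<longrightarrow> t (5::nat) (0::nat) \<noteq> (0::nat))"
  have "?I ?n (run (For 6 (Set 17 (Plus (Var 6) (Const 1)) ;; search_prog)) ?s)"
  proof (rule For_rule[where I = ?I])
    show "wf_prog (For 6 (Set 17 (Plus (Var 6) (Const 1)) ;; search_prog))"
      by (simp add: prog_defs)
    show "?s 0 0 = ?n" by (simp add: input_memory_def)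
    have "found_within d ?K ?s" by (simp add: found_within_def input_memory_def)
    then show "?I 0 (store ?s 6 0 0)" using MDS_seq_pos[OF gr n] found_within_store[of 6] by simp
  next
    fix i t assume t: "i < ?n" "t 0 0 = ?n" "t 6 0 = i" "?I i t"
    let ?t1 = "store t 17 0 (Suc i)"
    have t1: "?t1 0 0 = ?n" "?t1 17 0 = Suc i" "found_within d ?K ?t1" "?K < Suc i \<longrightarrow> ?t1 5 0 \<noteq> 0"
      using t found_within_store[of 17] by (auto simp: store_apply)
    have k: "1 \<le> Suc i" "Suc i \<le> ?n" using t(1) by auto
    note sp = search_prog_correct[OF t1(1,2) k deg t1(3,4)]
    let ?t2 = "run search_prog ?t1"
    have "?t2 5 0 \<noteq> 0" if "?K \<le> Suc i"
    proof (cases "?K = Suc i")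
      case True
      obtain E where E: "realizes E d" "covered ?n (Suc i) E" using covered_MDS_seq(1)[OF gr] True by metis
      have "\<forall>E D. realizes E d \<longrightarrow> dominating_set ?n E D \<longrightarrow> Suc i \<le> card D"
        using MDS_seq_minimal True by metis
      then show ?thesis using sp(3) exists_target_realization[OF deg k(2) _ E n] by blast
    next
      case False
      then show ?thesis using sp(2) t1(4) that by simp
    qed
    moreover have "run (Set 17 (Plus (Var 6) (Const 1)) ;; search_prog) t = ?t2" using t(3) by simp
    moreover have "store ?t2 6 0 (Suc i) 5 = ?t2 5" by (rule store_other) simp
    moreover have "found_within d ?K (store ?t2 6 0 (Suc i))"
      by (rule found_within_store[THEN iffD2, OF _ sp(1)]) simp
    ultimately show "?I (Suc i) (store (run (Set 17 (Plus (Var 6) (Const 1)) ;; search_prog) t) 6 0 (Suc i))"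
      by (simp only:) blast
  qed
  then have "?I ?n s'" unfolding s'_def main_prog_def .
  then obtain k where k: "realizes (output_graph s') d" "k \<le> ?K" "k \<le> ?n" "covered ?n k (output_graph s')"
    using covered_MDS_seq(2)[OF gr] unfolding found_within_def by blast
  have "dominating_set ?n (output_graph s') {..<k}"
    using covered_iff_dominating_set[OF k(3)] k(4) by blast
  then have "MDS_graph ?n (output_graph s') \<le> ?K" using MDS_graph_le k(2) by fastforce
  then show ?thesis using MDS_seq_le[OF k(1)] k(1) by simp
qed

text \<open>Treated apart because \<open>1 \<le> MDS_seq d\<close> requires a nonempty sequence. The
  outer loop makes no round, and the edge list left empty denotes the only realization.\<close>

lemma main_prog_correct_Nil:
  defines "s' \<equiv> run main_prog (input_memory [])"
  shows "realizes (output_graph s') [] \<and> MDS_graph 0 (output_graph s') = MDS_seq []"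
proof -
  have empty: "E = {}" if "realizes E []" for E
    using that by (simp add: realizes_def simple_graph_def)
  have "input_memory [] 0 0 = 0" by (simp add: input_memory_def)
  then have "s' = store (input_memory []) 6 0 0" by (simp add: s'_def main_prog_def)
  then have out: "output_graph s' = {}"
    by (simp add: output_graph_def store_apply input_memory_def)
  have real: "realizes {} []" by (simp add: realizes_def simple_graph_def)
  obtain E where "realizes E []" "MDS_graph (length ([] :: nat list)) E = MDS_seq []"
    using MDS_seq_attained[OF real] .
  then show ?thesis using empty[of E] real unfolding out by simp
qed

theorem theorem1:
  shows "\<exists>(prog :: com) (p :: nat poly). \<forall>d :: nat list. graphic d \<longrightarrow>
    (\<exists>t s. exec prog (input_memory d) t s \<and>
           t \<le> poly p (length d) \<and>
           realizes (output_graph s) d \<and>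
           MDS_graph (length d) (output_graph s) = MDS_seq d)"
proof (rule exI[of _ "compile main_prog"], rule exI[of _ "time_bound main_prog"], intro allI impI)
  fix d :: "nat list" assume gr: "graphic d"
  let ?s = "run main_prog (input_memory d)"
  obtain t where "exec (compile main_prog) (input_memory d) t ?s" "t \<le> poly (time_bound main_prog) (length d)"
    using exec_compile[OF wf_main_prog, of "input_memory d"] by (auto simp: input_memory_def)
  moreover have "realizes (output_graph ?s) d \<and> MDS_graph (length d) (output_graph ?s) = MDS_seq d"
    using main_prog_correct[OF gr] main_prog_correct_Nil by (cases "d = []") auto
  ultimately show "\<exists>t s. exec (compile main_prog) (input_memory d) t s \<and>
           t \<le> poly (time_bound main_prog) (length d) \<and>
           realizes (output_graph s) d \<and>
           MDS_graph (length d) (output_graph s) = MDS_seq d"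
    by blast
qed

end
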